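(* Let $Q\subset\mathbb{R}^d$ and $P\subset\mathbb{R}^e$ be lattice polytopes admitting unimodular triangulations $\mathcal S$ and $\mathcal{T}$ respectively, and let $\phi:\mathbb{R}^d\to\mathbb{R}$ be an affine function with $\phi(\mathbb{Z}^d)\subseteq\mathbb{Z}$ and $\phi\ge0$ on $Q$. Then the semidirect product $Q\ltimes_\phi P$ admits a unimodular triangulation that refines the pull-back $\pi^*\mathcal S$ of $\mathcal S$ under the projection $\pi:Q\ltimes_\phi P\to Q$.
   Context: The semidirect product is $Q\ltimes_\phi P=\operatorname{conv}\bigcup_{a\in Q}\left(\{a\}\times\phi(a)P\right)\subset\mathbb{R}^d\times\mathbb{R}^e$, and $\pi$ is the projection to the first factor. The pull-back $\pi^*\mathcal S$ is the subdivision of $Q\ltimes_\phi P$ into the sets $(Q\ltimes_\phi P)\cap\pi^{-1}(F)$, $F\in\mathcal S$; refining it means every cell is contained in one of these. Unimodular triangulation: lattice triangulation all of whose maximal simplices are lattice-equivalent to standard unimodular simplices. *)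

theory Defs
  imports "HOL-Analysis.Analysis"
begin

text \<open>The integer lattice of a Euclidean space with its standard basis; this is
  \<open>\<int>\<^sup>d\<close> for \<open>real ^ 'd\<close>, and \<open>\<int>\<^sup>d \<times> \<int>\<^sup>e\<close> for the product \<open>(real ^ 'd) \<times> (real ^ 'e)\<close>.\<close>

definition integer_points :: "'a::euclidean_space set" where
  "integer_points = {x. \<forall>b\<in>Basis. x \<bullet> b \<in> \<int>}"

definition affine_map :: "('a::real_vector \<Rightarrow> 'b::real_vector) \<Rightarrow> bool" where
  "affine_map f \<longleftrightarrow> (\<exists>g c. linear g \<and> (\<forall>x. f x = g x + c))"

definition lattice_polytope :: "'a::euclidean_space set \<Rightarrow> bool" where
  "lattice_polytope P \<longleftrightarrow> (\<exists>V. finite V \<and> V \<subseteq> integer_points \<and> P = convex hull V)"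

text \<open>Polytopes need not be full-dimensional, so the lattice relevant to \<open>A\<close> is
  \<open>integer_points \<inter> affine hull A\<close>. A map defined on \<open>affine hull A\<close> only would give the same
  notion, because it extends to an affine map of the whole space.\<close>

definition lattice_equivalent :: "'a::euclidean_space set \<Rightarrow> 'b::euclidean_space set \<Rightarrow> bool" where
  "lattice_equivalent A B \<longleftrightarrow>
     (\<exists>f. affine_map f \<and> inj_on f (affine hull A) \<and> f ` A = B \<and>
          f ` (integer_points \<inter> affine hull A) = integer_points \<inter> affine hull B)"

text \<open>The simplices with vertices \<open>0\<close> and \<open>k\<close> of the standard unit vectors, in any dimension
  \<open>k \<le> DIM('a)\<close>.\<close>

definition standard_unimodular_simplex :: "'a::euclidean_space set \<Rightarrow> bool" where
  "standard_unimodular_simplex D \<longleftrightarrow> (\<exists>B\<subseteq>Basis. D = convex hull (insert 0 B))"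

definition unimodular_simplex :: "'a::euclidean_space set \<Rightarrow> bool" where
  "unimodular_simplex S \<longleftrightarrow>
     (\<exists>D :: 'a set. standard_unimodular_simplex D \<and> lattice_equivalent S D)"

text \<open>As \<open>simplicial_complex\<close> is closed under faces, a nonempty triangulation contains the
  empty cell. The empty polytope is triangulated by \<open>{}\<close>.\<close>

definition lattice_triangulation :: "'a::euclidean_space set set \<Rightarrow> 'a set \<Rightarrow> bool" where
  "lattice_triangulation \<T> P \<longleftrightarrow>
     simplicial_complex \<T> \<and> \<Union>\<T> = P \<and> (\<forall>T\<in>\<T>. lattice_polytope T)"

definition unimodular_triangulation :: "'a::euclidean_space set set \<Rightarrow> 'a set \<Rightarrow> bool" where
  "unimodular_triangulation \<T> P \<longleftrightarrow>
     lattice_triangulation \<T> P \<and>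
     (\<forall>T\<in>\<T>. (\<forall>T'\<in>\<T>. T \<subseteq> T' \<longrightarrow> T' = T) \<longrightarrow> unimodular_simplex T)"

definition semidirect_product ::
  "'a::euclidean_space set \<Rightarrow> ('a \<Rightarrow> real) \<Rightarrow> 'b::euclidean_space set \<Rightarrow> ('a \<times> 'b) set" where
  "semidirect_product Q \<phi> P = convex hull (\<Union>a\<in>Q. {a} \<times> ((\<lambda>x. \<phi> a *\<^sub>R x) ` P))"

definition pullback_subdivision :: "('a \<times> 'b) set \<Rightarrow> 'a set set \<Rightarrow> ('a \<times> 'b) set set" where
  "pullback_subdivision X \<S> = (\<lambda>F. X \<inter> fst -` F) ` \<S>"

definition refines_subdivision :: "'a set set \<Rightarrow> 'a set set \<Rightarrow> bool" where
  "refines_subdivision \<U> \<V> \<longleftrightarrow> (\<forall>U\<in>\<U>. \<exists>V\<in>\<V>. U \<subseteq> V)"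

end

theory Submission
  imports Defs
begin

text \<open>
  A point of the semidirect product is \<open>(a, y)\<close> with \<open>a = (\<Sum>v. \<mu> v *\<^sub>R v)\<close> in a simplex of \<open>\<S>\<close> and
  \<open>y = (\<Sum>w. \<nu> w *\<^sub>R w)\<close>, where the support of \<open>\<nu>\<close> spans a simplex of \<open>\<T>\<close> and
  \<open>(\<Sum>w. \<nu> w) = \<phi> a = (\<Sum>v. \<mu> v * \<phi> v)\<close>. Order the vertices of \<open>\<S>\<close> by decreasing \<open>\<phi>\<close> and enumerate
  those of \<open>\<T>\<close> arbitrarily. Cut the interval of length \<open>\<phi> a\<close> into pieces of lengths \<open>\<nu> w\<close>, in the order
  of the \<open>w\<close>, and also into layers \<open>k = 0, 1, \<dots>\<close> of lengths \<open>\<Sum>{\<mu> v | \<phi> v > k}\<close>. Stacking the layers, each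
  \<open>\<theta>\<close> in \<open>[0, 1)\<close> selects a vertex \<open>v\<close> (from the lengths \<open>\<mu>\<close>) and, in each of the \<open>\<phi> v\<close> layers below
  \<open>\<theta>\<close>, a vertex \<open>w\<close>; this is a lattice point \<open>(v, w\<^sub>1 + \<dots>)\<close>, and averaging it over \<open>\<theta>\<close> gives back \<open>(a, y)\<close>.
  The finitely many lattice points that occur are the vertices of the cell through \<open>(a, y)\<close>.
  They form a chain for an interlacing condition, and the partial sums of barycentric coordinates along a
  chain are integral combinations of the \<open>\<mu> v\<close> and \<open>\<nu> w\<close>, which yields unimodularity.
\<close>

section \<open>Unimodular complexes of vertex sets\<close>

text \<open>Simplices are represented by their vertex sets. The clause on \<open>c\<close> says that
  lattice points in the affine span have integral barycentric coordinates; this is unimodularity,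
  and it also forces affine independence. The last clause makes the relative interiors of distinct
  simplices disjoint, from which the intersection property of a complex follows.\<close>

definition unimodular_complex :: "'a::euclidean_space set set \<Rightarrow> bool" where
  "unimodular_complex K \<longleftrightarrow>
     finite K \<and> (\<forall>A\<in>K. finite A \<and> A \<subseteq> integer_points) \<and> (\<forall>A\<in>K. \<forall>B. B \<subseteq> A \<longrightarrow> B \<in> K) \<and>
     (\<forall>A\<in>K. \<forall>c. sum c A = 1 \<longrightarrow> (\<Sum>x\<in>A. c x *\<^sub>R x) \<in> integer_points \<longrightarrow> (\<forall>x\<in>A. c x \<in> \<int>)) \<and>
     (\<forall>A\<in>K. \<forall>B\<in>K. \<forall>\<alpha> \<beta>. (\<forall>x\<in>A. 0 < \<alpha> x) \<longrightarrow> (\<forall>x\<in>B. 0 < \<beta> x) \<longrightarrow> sum \<alpha> A = 1 \<longrightarrow> sum \<beta> B = 1 \<longrightarrow>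
        (\<Sum>x\<in>A. \<alpha> x *\<^sub>R x) = (\<Sum>x\<in>B. \<beta> x *\<^sub>R x) \<longrightarrow> A = B)"

lemma integer_points_sum:
  assumes "\<And>i. i \<in> I \<Longrightarrow> c i \<in> \<int>" "\<And>i. i \<in> I \<Longrightarrow> p i \<in> integer_points"
  shows "(\<Sum>i\<in>I. c i *\<^sub>R p i) \<in> integer_points"
  using assms by (auto simp: integer_points_def inner_sum_left intro!: Ints_sum Ints_mult)

lemma unimodular_complex_finite: "unimodular_complex K \<Longrightarrow> finite K"
  and unimodular_complex_finite_simplex: "unimodular_complex K \<Longrightarrow> A \<in> K \<Longrightarrow> finite A"
  and unimodular_complex_integer_points: "unimodular_complex K \<Longrightarrow> A \<in> K \<Longrightarrow> A \<subseteq> integer_points"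
  and unimodular_complex_subset: "unimodular_complex K \<Longrightarrow> A \<in> K \<Longrightarrow> B \<subseteq> A \<Longrightarrow> B \<in> K"
  by (simp_all add: unimodular_complex_def)

lemma unimodular_complex_Ints:
  assumes "unimodular_complex K" "A \<in> K" "sum c A = 1"
    "(\<Sum>x\<in>A. c x *\<^sub>R x) \<in> integer_points" "x \<in> A"
  shows "c x \<in> \<int>"
  using assms(1)[unfolded unimodular_complex_def, THEN conjunct2, THEN conjunct2, THEN conjunct2,
      THEN conjunct1, rule_format, OF assms(2-)] .

lemma unimodular_complex_unique:
  assumes "unimodular_complex K" "A \<in> K" "B \<in> K"
    and "\<And>x. x \<in> A \<Longrightarrow> 0 < \<alpha> x" "\<And>x. x \<in> B \<Longrightarrow> 0 < \<beta> x" "sum \<alpha> A = 1" "sum \<beta> B = 1"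
    and "(\<Sum>x\<in>A. \<alpha> x *\<^sub>R x) = (\<Sum>x\<in>B. \<beta> x *\<^sub>R x)"
  shows "A = B"
  using assms(1)[unfolded unimodular_complex_def, THEN conjunct2, THEN conjunct2, THEN conjunct2,
      THEN conjunct2, rule_format, OF assms(2-)] .

text \<open>Turns integrality along a whole line of coefficient vectors into the vanishing of a
  coefficient.\<close>

lemma eq_0_if_multiples_Ints:
  fixes c :: real
  assumes "\<And>t. t * c \<in> \<int>"
  shows "c = 0"
proof (rule ccontr)
  assume "c \<noteq> 0"
  then have "(1/2::real) \<in> \<int>" using assms[of "1 / (2 * c)"] by simp
  then obtain k where "(1/2::real) = of_int k" by (auto elim: Ints_cases)
  then have "2 * k = 1" by linarith
  then show False by presburger
qed

text \<open>An affine dependence \<open>u\<close> can be added, in any real multiple, to the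
  coordinates of the vertex \<open>v\<close> without moving the lattice point \<open>v\<close>. So
  all real multiples of \<open>u v\<close> are integers, which forces
  \<open>u v = 0\<close>.\<close>

lemma unimodular_complex_independent:
  assumes K: "unimodular_complex K" "A \<in> K"
  shows "\<not> affine_dependent A"
proof
  assume "affine_dependent A"
  moreover have fin: "finite A" using K by (rule unimodular_complex_finite_simplex)
  ultimately obtain u v where u: "sum u A = 0" "v \<in> A" "u v \<noteq> 0" "(\<Sum>x\<in>A. u x *\<^sub>R x) = 0"
    unfolding affine_dependent_explicit_finite[OF fin] by blast
  have "t * u v \<in> \<int>" for t
  proof -
    let ?c = "\<lambda>x. t * u x + (if x = v then 1 else 0)"
    have s1: "sum ?c A = 1"
      using u fin by (simp add: sum.distrib sum_distrib_left[symmetric])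
    have "(\<Sum>x\<in>A. ?c x *\<^sub>R x) = t *\<^sub>R (\<Sum>x\<in>A. u x *\<^sub>R x) + (\<Sum>x\<in>A. (if x = v then 1 else 0) *\<^sub>R x)"
      by (simp add: scaleR_add_left sum.distrib scaleR_sum_right)
    also have "(\<Sum>x\<in>A. (if x = v then 1 else 0) *\<^sub>R x) = (\<Sum>x\<in>A. if x = v then x else 0)"
      by (rule sum.cong) auto
    also have "\<dots> = v" using fin u by simp
    finally have "(\<Sum>x\<in>A. ?c x *\<^sub>R x) \<in> integer_points"
      using u unimodular_complex_integer_points[OF K] by auto
    from unimodular_complex_Ints[OF K s1 this u(2)] show ?thesis
      by (metis Ints_1 Ints_diff add_diff_cancel_right')
  qed
  then show False using eq_0_if_multiples_Ints u by blast
qed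

lemma unimodular_complex_weights:
  assumes K: "unimodular_complex K" "A \<in> K" "B \<in> K"
    and pos: "\<And>x. x \<in> A \<Longrightarrow> 0 < \<alpha> x" "\<And>x. x \<in> B \<Longrightarrow> 0 < \<beta> x"
    and s: "sum \<alpha> A = 1" "sum \<beta> B = 1" and eq: "(\<Sum>x\<in>A. \<alpha> x *\<^sub>R x) = (\<Sum>x\<in>B. \<beta> x *\<^sub>R x)"
  shows "A = B" "x \<in> A \<Longrightarrow> \<alpha> x = \<beta> x"
proof -
  show AB: "A = B" using unimodular_complex_unique[OF assms(1-3) pos s eq] by auto
  have fin: "finite A" using K by (auto intro: unimodular_complex_finite_simplex)
  have "sum (\<lambda>x. \<alpha> x - \<beta> x) A = 0" "(\<Sum>x\<in>A. (\<alpha> x - \<beta> x) *\<^sub>R x) = 0"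
    using s eq AB by (simp_all add: sum_subtractf scaleR_diff_left)
  with unimodular_complex_independent[OF K(1,2)]
  show "x \<in> A \<Longrightarrow> \<alpha> x = \<beta> x"
    unfolding affine_dependent_explicit_finite[OF fin] by force
qed

section \<open>From a unimodular triangulation to a complex of vertex sets\<close>

lemma affine_map_convex_hull: "affine_map f \<Longrightarrow> f ` (convex hull S) = convex hull (f ` S)"
  and affine_map_affine_hull: "affine_map f \<Longrightarrow> f ` (affine hull S) = affine hull (f ` S)"
  and affine_map_sum: "affine_map f \<Longrightarrow> sum c A = 1 \<Longrightarrow> f (\<Sum>x\<in>A. c x *\<^sub>R x) = (\<Sum>x\<in>A. c x *\<^sub>R f x)"
  for f :: "'a::euclidean_space \<Rightarrow> 'b::euclidean_space"
proof -
  assume "affine_map f"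
  then obtain g d where g: "linear g" and fg: "\<And>x. f x = g x + d" unfolding affine_map_def by blast
  have eq: "f ` S = (+) d ` (g ` S)" for S by (auto simp: fg image_image add.commute)
  show "f ` (convex hull S) = convex hull (f ` S)"
    unfolding eq convex_hull_translation convex_hull_linear_image[OF g] ..
  show "f ` (affine hull S) = affine hull (f ` S)"
    unfolding eq affine_hull_translation using affine_hull_linear_image[of g S] g
    by (simp add: linear_conv_bounded_linear)
  show "f (\<Sum>x\<in>A. c x *\<^sub>R x) = (\<Sum>x\<in>A. c x *\<^sub>R f x)" if "sum c A = 1"
    using that by (simp add: fg linear_sum[OF g] linear_cmul[OF g] scaleR_add_right sum.distrib
        flip: scaleR_sum_left)
qed

text \<open>A lattice equivalence onto a standard simplex carries the vertices to the origin and
  unit vectors. The barycentric coordinates are then standard coordinates of an integer point,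
  except the one at the origin, which is 1 minus the others.\<close>

lemma unimodular_simplex_Ints:
  assumes A: "\<not> affine_dependent A" and um: "unimodular_simplex (convex hull A)"
    and c: "sum c A = 1" "(\<Sum>x\<in>A. c x *\<^sub>R x) \<in> integer_points" "x \<in> A"
  shows "c x \<in> \<int>"
proof -
  have fin: "finite A" using A aff_independent_finite by blast
  obtain D :: "'a set" where D: "standard_unimodular_simplex D" "lattice_equivalent (convex hull A) D"
    using um unfolding unimodular_simplex_def by blast
  obtain B where B: "B \<subseteq> Basis" and DB: "D = convex hull (insert 0 B)"
    using D(1) unfolding standard_unimodular_simplex_def by blast
  obtain f where f: "affine_map f" and inj: "inj_on f (affine hull A)"
    and im: "f ` (convex hull A) = convex hull (insert 0 B)"
    and lat: "f ` (integer_points \<inter> affine hull A) = integer_points \<inter> affine hull (insert 0 B)"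
    using D(2) unfolding lattice_equivalent_def DB affine_hull_convex_hull by blast
  note fconv = affine_map_convex_hull[OF f]
  have "independent B" "0 \<notin> B" using B independent_mono[OF independent_Basis] nonzero_Basis by auto
  then have indB: "\<not> affine_dependent (insert 0 B)"
    using affine_dependent_iff_dependent[of 0 B] by simp
  have sub: "insert 0 B \<subseteq> f ` A"
  proof
    fix b assume "b \<in> insert 0 B"
    then have "b extreme_point_of convex hull (f ` A)"
      using extreme_point_of_convex_hull_affine_independent[OF indB] im fconv by auto
    then show "b \<in> f ` A" by (rule extreme_point_of_convex_hull)
  qed
  \<comment> \<open>The vertices that map into \<open>insert 0 B\<close> already have the whole
    image as the hull of their images. Were \<open>y\<close> not among them, injectivity would put
    \<open>y\<close> into their affine hull, against affine independence.\<close>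
  have fA: "f y \<in> insert 0 B" if y: "y \<in> A" for y
  proof -
    let ?B = "{a \<in> A. f a \<in> insert 0 B}"
    have "f ` ?B = insert 0 B" using sub by auto
    then have "f y \<in> f ` (convex hull ?B)" using y im fconv[of ?B] hull_inc[OF y] by (metis image_eqI)
    then obtain z where z: "z \<in> convex hull ?B" "f y = f z" by auto
    have "z \<in> affine hull A" using z(1)
      by (metis (no_types, lifting) convex_hull_subset_affine_hull hull_mono mem_Collect_eq subsetI subsetD)
    then have "z = y" using z(2) inj y by (metis hull_inc inj_onD)
    then have yc: "y \<in> affine hull ?B" using z(1) convex_hull_subset_affine_hull by blast
    show ?thesis
    proof (rule ccontr)
      assume "f y \<notin> insert 0 B"
      then have "?B \<subseteq> A - {y}" by auto
      then have "y \<in> affine hull (A - {y})" using yc hull_mono by blast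
      then show False using A y unfolding affine_dependent_def by blast
    qed
  qed
  let ?z = "\<Sum>x\<in>A. c x *\<^sub>R x"
  have zA: "?z \<in> affine hull A" unfolding affine_hull_finite[OF fin] using c by auto
  have fz: "f ?z = (\<Sum>x\<in>A. c x *\<^sub>R f x)"
    by (rule affine_map_sum[OF f c(1)])
  have fzi: "f ?z \<in> integer_points" using lat zA c(2) by blast
  have injA: "inj_on f A" using inj by (meson hull_subset inj_on_subset)
  have nz: "c y \<in> \<int>" if y: "y \<in> A" "f y \<noteq> 0" for y
  proof -
    have bB: "f y \<in> B" using fA y by auto
    have "f ?z \<bullet> f y = (\<Sum>x\<in>A. c x * (f x \<bullet> f y))" by (simp add: fz inner_sum_left)
    also have "\<dots> = (\<Sum>x\<in>A. if x = y then c x else 0)"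
    proof (rule sum.cong)
      fix x assume x: "x \<in> A"
      show "c x * (f x \<bullet> f y) = (if x = y then c x else 0)"
      proof (cases "x = y")
        case False
        then have "f x \<noteq> f y" using inj_onD[OF injA _ x y(1)] by blast
        then show ?thesis using fA[OF x] bB B False by (auto simp: inner_not_same_Basis subset_iff)
      qed (use bB B in auto)
    qed simp
    also have "\<dots> = c y" using y fin by simp
    finally have "f ?z \<bullet> f y = c y" .
    moreover have "f ?z \<bullet> f y \<in> \<int>" using fzi bB B by (auto simp: integer_points_def)
    ultimately show ?thesis by simp
  qed
  show ?thesis
  proof (cases "f x = 0")
    case True
    have "c x = 1 - sum c (A - {x})" using c fin by (simp add: sum_diff1)
    moreover have "sum c (A - {x}) \<in> \<int>"
    proof (rule Ints_sum)
      fix y assume "y \<in> A - {x}"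
      then show "c y \<in> \<int>" using nz[of y] inj_onD[OF injA, of x y] c(3) True by fastforce
    qed
    ultimately show ?thesis by simp
  qed (use nz c in blast)
qed

text \<open>The complex consists of all affinely independent sets that span a cell. They correspond
  bijectively to the cells, because they are the sets of extreme points.\<close>

lemma unimodular_triangulation_imp_complex:
  assumes T: "unimodular_triangulation \<T> P"
  obtains K where "unimodular_complex K" "\<T> = (\<lambda>A. convex hull A) ` K" "P = (\<Union>A\<in>K. convex hull A)"
proof
  let ?K = "{A. \<not> affine_dependent A \<and> convex hull A \<in> \<T>}"
  have sc: "simplicial_complex \<T>" and P: "\<Union>\<T> = P" and lat: "\<And>T. T \<in> \<T> \<Longrightarrow> lattice_polytope T"
    and um: "\<And>T. T \<in> \<T> \<Longrightarrow> (\<forall>T'\<in>\<T>. T \<subseteq> T' \<longrightarrow> T' = T) \<Longrightarrow> unimodular_simplex T"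
    using T unfolding unimodular_triangulation_def lattice_triangulation_def by auto
  have finT: "finite \<T>" using sc unfolding simplicial_complex_def by blast
  show eq: "\<T> = (\<lambda>A. convex hull A) ` ?K"
  proof (intro equalityI subsetI)
    fix T assume T: "T \<in> \<T>"
    then obtain n where "n simplex T" using sc unfolding simplicial_complex_def by meson
    then show "T \<in> (\<lambda>A. convex hull A) ` ?K" using T unfolding simplex_def by auto
  qed auto
  then show "P = (\<Union>A\<in>?K. convex hull A)" using P by auto
  \<comment> \<open>The smaller of two nested cells is their intersection, hence a face of the
    larger one, and extreme points of a face are extreme in the whole cell.\<close>
  have sub: "A \<subseteq> A'" if "A \<in> ?K" "A' \<in> ?K" "convex hull A \<subseteq> convex hull A'" for A A'
  proof
    have "convex hull A face_of convex hull A'"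
      using sc that unfolding simplicial_complex_def by (metis (lifting) Int_absorb1 mem_Collect_eq)
    fix x assume "x \<in> A"
    then have "x extreme_point_of convex hull A"
      using that(1) by (simp add: extreme_point_of_convex_hull_affine_independent)
    then have "x extreme_point_of convex hull A'"
      using \<open>convex hull A face_of convex hull A'\<close> extreme_point_of_face by blast
    then show "x \<in> A'" by (rule extreme_point_of_convex_hull)
  qed
  have "inj_on (\<lambda>A. convex hull A) ?K" 
  proof (rule inj_onI)
    fix A B assume AB: "A \<in> ?K" "B \<in> ?K" "convex hull A = convex hull B"
    show "A = B"
      by (rule subset_antisym[OF sub[OF AB(1,2) eq_refl[OF AB(3)]] sub[OF AB(2,1) eq_refl[OF AB(3)[symmetric]]]])
  qed
  moreover have "finite ((\<lambda>A. convex hull A) ` ?K)" by (rule subst[OF eq, of finite, OF finT])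
  ultimately have finK: "finite ?K" by (rule finite_imageD[rotated])
  have down: "B \<in> ?K" if "A \<in> ?K" "B \<subseteq> A" for A B
  proof -
    have "convex hull B face_of convex hull A"
      using that face_of_convex_hull_affine_independent[of A] by blast
    then show ?thesis using that sc affine_independent_subset unfolding simplicial_complex_def by blast
  qed
  have ints: "c x \<in> \<int>" if A: "A \<in> ?K" and c: "sum c A = 1" "(\<Sum>x\<in>A. c x *\<^sub>R x) \<in> integer_points" "x \<in> A" for A c x
  proof -
    \<comment> \<open>Unimodularity is given for maximal cells only, so the coefficients are
      extended by zero to a maximal cell that contains \<open>convex hull A\<close>.\<close>
    have "convex hull A \<in> \<T>" using A by auto
    from finite_has_maximal2[OF finT this]
    obtain M where M: "M \<in> \<T>" "convex hull A \<subseteq> M" "\<forall>T'\<in>\<T>. M \<subseteq> T' \<longrightarrow> M = T'" by blast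
    then obtain A' where A': "A' \<in> ?K" "M = convex hull A'" using eq by blast
    have AA': "A \<subseteq> A'" using sub A A' M by blast
    have fin: "finite A'" using A' aff_independent_finite by blast
    let ?c = "\<lambda>x. if x \<in> A then c x else 0"
    have "sum ?c A' = 1" using c(1) AA' fin by (simp add: sum.If_cases Int_absorb1)
    moreover have "(\<Sum>x\<in>A'. ?c x *\<^sub>R x) = (\<Sum>x\<in>A. c x *\<^sub>R x)"
      by (rule sum.mono_neutral_cong_right) (use AA' fin in auto)
    moreover have "unimodular_simplex (convex hull A')" using um[OF M(1)] M A' by metis
    ultimately have "?c x \<in> \<int>" using unimodular_simplex_Ints[of A' ?c x] A' c AA' by auto
    then show ?thesis using c by simp
  qed
  have uniq: "A = B" if AB: "A \<in> ?K" "B \<in> ?K" and p: "\<forall>x\<in>A. 0 < \<alpha> x" "\<forall>x\<in>B. 0 < \<beta> x" 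
    and s: "sum \<alpha> A = 1" "sum \<beta> B = 1" and e: "(\<Sum>x\<in>A. \<alpha> x *\<^sub>R x) = (\<Sum>x\<in>B. \<beta> x *\<^sub>R x)" for A B and \<alpha> \<beta> :: "'a \<Rightarrow> real"
  proof -
    \<comment> \<open>Positive weights put \<open>?z\<close> into both relative interiors. A face
      that meets the relative interior is the whole cell, so the intersection equals both
      cells.\<close>
    let ?z = "\<Sum>x\<in>A. \<alpha> x *\<^sub>R x"
    have rA: "?z \<in> rel_interior (convex hull A)" "?z \<in> rel_interior (convex hull B)"
      using AB p s e rel_interior_convex_hull_explicit[of A] rel_interior_convex_hull_explicit[of B] by auto
    let ?I = "convex hull A \<inter> convex hull B"
    have fc: "S \<inter> S' face_of S" if "S \<in> \<T>" "S' \<in> \<T>" for S S'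
      using sc that unfolding simplicial_complex_def by simp
    have "?I face_of convex hull A" "?I face_of convex hull B"
      using fc[of "convex hull A" "convex hull B"] fc[of "convex hull B" "convex hull A"] AB
      by (simp_all add: Int_commute)
    moreover have "?z \<in> ?I" using rA rel_interior_subset by blast
    ultimately have I: "?I = convex hull A" "?I = convex hull B"
      using face_of_disjoint_rel_interior[of ?I] rA by (meson disjoint_iff)+
    then have "convex hull A = convex hull B" by simp
    then show ?thesis using sub[OF AB] sub[OF AB(2,1)] by (intro subset_antisym) simp_all
  qed
  have int: "A \<subseteq> integer_points" if A: "A \<in> ?K" for A
  proof
    fix x assume x: "x \<in> A"
    obtain V where V: "V \<subseteq> integer_points" "convex hull A = convex hull V" 
      using lat A unfolding lattice_polytope_def by blast
    then show "x \<in> integer_points"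
      using x A by (metis (no_types, lifting) extreme_point_of_convex_hull extreme_point_of_convex_hull_affine_independent mem_Collect_eq subsetD)
  qed
  show "unimodular_complex ?K"
    unfolding unimodular_complex_def
  proof (intro conjI)
    show "finite ?K" by (rule finK)
    show "\<forall>A\<in>?K. finite A \<and> A \<subseteq> integer_points" using int aff_independent_finite by blast
    show "\<forall>A\<in>?K. \<forall>B. B \<subseteq> A \<longrightarrow> B \<in> ?K" by (intro ballI allI impI) (rule down)
    show "\<forall>A\<in>?K. \<forall>c. sum c A = 1 \<longrightarrow> (\<Sum>x\<in>A. c x *\<^sub>R x) \<in> integer_points \<longrightarrow> (\<forall>x\<in>A. c x \<in> \<int>)"
      by (intro ballI allI impI) (rule ints)
    show "\<forall>A\<in>?K. \<forall>B\<in>?K. \<forall>\<alpha> \<beta>. (\<forall>x\<in>A. 0 < \<alpha> x) \<longrightarrow> (\<forall>x\<in>B. 0 < \<beta> x) \<longrightarrow>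
        sum \<alpha> A = 1 \<longrightarrow> sum \<beta> B = 1 \<longrightarrow> (\<Sum>x\<in>A. \<alpha> x *\<^sub>R x) = (\<Sum>x\<in>B. \<beta> x *\<^sub>R x) \<longrightarrow> A = B"
      by (intro ballI allI impI) (rule uniq)
  qed
qed


section \<open>From a complex of vertex sets back to a triangulation\<close>

lemma unimodular_complex_simplex:
  fixes A :: "'a::euclidean_space set"
  assumes K: "unimodular_complex K" "A \<in> K" and "A \<noteq> {}"
  shows "unimodular_simplex (convex hull A)"
proof -
  obtain a where a: "a \<in> A" using \<open>A \<noteq> {}\<close> by blast
  have fin: "finite A" using K by (rule unimodular_complex_finite_simplex)
  have ind: "independent ((\<lambda>x. - a + x) ` (A - {a}))" 
    using unimodular_complex_independent[OF K] affine_dependent_iff_dependent2[OF a] by blast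
  \<comment> \<open>Independence bounds the number of vertices other than \<open>a\<close>, so that
    there are enough unit vectors to receive them.\<close>
  have "card (A - {a}) \<le> DIM('a)"
    using independent_card_le[OF ind] by (simp add: card_image)
  then obtain B where B: "B \<subseteq> (Basis :: 'a set)" "card B = card (A - {a})" "finite B"
    by (metis obtain_subset_with_card_n)
  then obtain h where h: "bij_betw h (A - {a}) B"
    using finite_same_card_bij fin by (metis finite_Diff)
  \<comment> \<open>The equivalence sends \<open>a\<close> to the origin and the other vertices to
    the chosen unit vectors.\<close>
  obtain g where g: "linear g" "\<forall>y \<in> (\<lambda>x. - a + x) ` (A - {a}). g y = h (a + y)"
    using linear_independent_extend[OF ind, of "\<lambda>y. h (a + y)"] by blast
  define f where "f z = g z + - g a" for z
  have f: "affine_map f" unfolding affine_map_def f_def using g(1) by blast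
  have fa: "f a = 0" by (simp add: f_def)
  have fh: "f x = h x" if "x \<in> A - {a}" for x
    using g that linear_diff[OF g(1), of x a] by (auto simp: f_def)
  have hB: "h x \<in> Basis" if "x \<in> A - {a}" for x
    using h B that by (meson bij_betwE subsetD)
  have fA: "f ` A = insert 0 B"
  proof -
    have "f ` A = insert (f a) (f ` (A - {a}))" using a by blast
    also have "f ` (A - {a}) = h ` (A - {a})" using fh by (rule image_cong[OF refl])
    finally show ?thesis using h fa by (simp add: bij_betw_def)
  qed
  \<comment> \<open>Inner products with the unit vectors read off the barycentric coordinates. This
    gives injectivity, and integral coordinates for every point with integral image.\<close>
  have coord: "f (\<Sum>x\<in>A. c x *\<^sub>R x) \<bullet> h y = c y" if c: "sum c A = 1" and y: "y \<in> A - {a}" for c y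
  proof -
    have "f (\<Sum>x\<in>A. c x *\<^sub>R x) \<bullet> h y = (\<Sum>x\<in>A. c x * (f x \<bullet> h y))"
      by (simp add: affine_map_sum[OF f c] inner_sum_left)
    also have "\<dots> = (\<Sum>x\<in>A. if x = y then c x else 0)"
    proof (rule sum.cong)
      fix x assume x: "x \<in> A"
      consider "x = y" | "x = a" "x \<noteq> y" | "x \<in> A - {a}" "x \<noteq> y" using x by blast
      then show "c x * (f x \<bullet> h y) = (if x = y then c x else 0)"
      proof cases
        case 3
        then have "h x \<noteq> h y" using h y by (metis bij_betw_def inj_onD)
        then show ?thesis using 3 fh hB y by (simp add: inner_not_same_Basis)
      qed (use fa fh[OF y] hB[OF y] in auto)
    qed simp
    also have "\<dots> = c y" using y fin by simp
    finally show ?thesis .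
  qed
  have ca: "c a = 1 - sum c (A - {a})" if "sum c A = 1" for c :: "'a \<Rightarrow> real"
    using that a fin by (simp add: sum_diff1)
  have inj: "inj_on f (affine hull A)"
  proof (rule inj_onI)
    fix y z assume "y \<in> affine hull A" "z \<in> affine hull A" and eq: "f y = f z"
    then obtain c d where c: "sum c A = 1" "y = (\<Sum>x\<in>A. c x *\<^sub>R x)"
      and d: "sum d A = 1" "z = (\<Sum>x\<in>A. d x *\<^sub>R x)"
      unfolding affine_hull_finite[OF fin] by blast
    have cd: "c x = d x" if "x \<in> A - {a}" for x using coord[OF c(1) that] coord[OF d(1) that] eq c d by simp
    then have "sum c (A - {a}) = sum d (A - {a})" by (rule sum.cong[OF refl])
    then have "c a = d a" using ca[OF c(1)] ca[OF d(1)] by simp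
    with cd have "c x = d x" if "x \<in> A" for x using that by blast
    then show "y = z" using c d by simp
  qed
  have "f ` (integer_points \<inter> affine hull A) = integer_points \<inter> affine hull (insert 0 B)"
  proof (intro equalityI subsetI)
    fix y assume "y \<in> f ` (integer_points \<inter> affine hull A)"
    then obtain z where z: "y = f z" "z \<in> integer_points" "z \<in> affine hull A" by blast
    then obtain c where c: "sum c A = 1" "z = (\<Sum>x\<in>A. c x *\<^sub>R x)"
      unfolding affine_hull_finite[OF fin] by blast
    have "f x \<in> integer_points" if "x \<in> A" for x
    proof -
      have "f x \<in> insert 0 B" using fA that by blast
      then show ?thesis using B(1) by (auto simp: integer_points_def inner_Basis)
    qed
    then have "y \<in> integer_points" unfolding z(1) c(2) affine_map_sum[OF f c(1)]
      using unimodular_complex_Ints[OF K c(1)] z(2) c(2) by (intro integer_points_sum) auto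
    moreover have "y \<in> affine hull (insert 0 B)"
      unfolding z(1) fA[symmetric] affine_map_affine_hull[OF f, symmetric] using z(3) by (rule imageI)
    ultimately show "y \<in> integer_points \<inter> affine hull (insert 0 B)" ..
  next
    fix y assume y: "y \<in> integer_points \<inter> affine hull (insert 0 B)"
    then obtain z where z: "y = f z" "z \<in> affine hull A" using affine_map_affine_hull[OF f, of A] fA by auto
    then obtain c where c: "sum c A = 1" "z = (\<Sum>x\<in>A. c x *\<^sub>R x)"
      unfolding affine_hull_finite[OF fin] by blast
    have cI: "c x \<in> \<int>" if "x \<in> A - {a}" for x
    proof -
      have "y \<bullet> h x \<in> \<int>" using y hB[OF that] by (auto simp: integer_points_def)
      then show ?thesis using coord[OF c(1) that] z c by simp
    qed
    then have "c a \<in> \<int>" unfolding ca[OF c(1)] by (intro Ints_diff Ints_1 Ints_sum)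
    then have "c x \<in> \<int>" if "x \<in> A" for x using that cI by blast
    then have "z \<in> integer_points" unfolding c(2)
      using unimodular_complex_integer_points[OF K] by (intro integer_points_sum) auto
    then show "y \<in> f ` (integer_points \<inter> affine hull A)" using z by blast
  qed
  then have "lattice_equivalent (convex hull A) (convex hull (insert 0 B))"
    unfolding lattice_equivalent_def affine_hull_convex_hull
    by (intro exI[of _ f]) (simp add: f inj affine_map_convex_hull[OF f, of A] fA)
  then show ?thesis unfolding unimodular_simplex_def standard_unimodular_simplex_def using B(1) by blast
qed

lemma convex_hull_positive_weights:
  assumes "finite A" "z \<in> convex hull A"
  obtains B \<alpha> where "B \<subseteq> A" "\<And>x. x \<in> B \<Longrightarrow> 0 < \<alpha> x" "sum \<alpha> B = 1" "(\<Sum>x\<in>B. \<alpha> x *\<^sub>R x) = z"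
proof -
  obtain u where u: "\<forall>x\<in>A. 0 \<le> u x" "sum u A = 1" "(\<Sum>x\<in>A. u x *\<^sub>R x) = z"
    using assms unfolding convex_hull_finite[OF assms(1)] by blast
  let ?B = "{x \<in> A. u x \<noteq> 0}"
  have "sum u ?B = 1" unfolding u(2)[symmetric]
    using assms(1) by (intro sum.mono_neutral_left) auto
  moreover have "(\<Sum>x\<in>?B. u x *\<^sub>R x) = z" unfolding u(3)[symmetric]
    using assms(1) by (intro sum.mono_neutral_left) auto
  moreover have "0 < u x" if "x \<in> ?B" for x using that u(1) by force
  ultimately show ?thesis using that[of ?B u] by blast
qed

text \<open>Once vertices of weight zero are dropped, both representations of a common point have
  positive weights, so the uniqueness clause identifies their supports, and these lie in
  \<open>A \<inter> B\<close>.\<close>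

lemma unimodular_complex_convex_hull_Int:
  assumes K: "unimodular_complex K" "A \<in> K" "B \<in> K"
  shows "convex hull A \<inter> convex hull B = convex hull (A \<inter> B)"
proof
  show "convex hull A \<inter> convex hull B \<subseteq> convex hull (A \<inter> B)"
  proof
    fix z assume z: "z \<in> convex hull A \<inter> convex hull B"
    have fin: "finite A" "finite B" using K unimodular_complex_finite_simplex by blast+
    obtain A' \<alpha> where A': "A' \<subseteq> A" "\<And>x. x \<in> A' \<Longrightarrow> 0 < \<alpha> x" "sum \<alpha> A' = 1" "(\<Sum>x\<in>A'. \<alpha> x *\<^sub>R x) = z"
      using convex_hull_positive_weights[OF fin(1)] z by blast
    obtain B' \<beta> where B': "B' \<subseteq> B" "\<And>x. x \<in> B' \<Longrightarrow> 0 < \<beta> x" "sum \<beta> B' = 1" "(\<Sum>x\<in>B'. \<beta> x *\<^sub>R x) = z"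
      using convex_hull_positive_weights[OF fin(2)] z by blast
    have "A' \<in> K" "B' \<in> K" using unimodular_complex_subset[OF K(1)] K A'(1) B'(1) by blast+
    then have "A' = B'"
      by (rule unimodular_complex_unique[OF K(1) _ _ A'(2) B'(2) A'(3) B'(3) A'(4)[folded B'(4)]])
    then have "A' \<subseteq> A \<inter> B" using A' B' by blast
    moreover have "z \<in> convex hull A'"
      unfolding convex_hull_finite[OF finite_subset[OF A'(1) fin(1)]] using A' by (auto intro: less_imp_le)
    ultimately show "z \<in> convex hull (A \<inter> B)" using hull_mono by blast
  qed
qed (simp add: hull_mono)

text \<open>For \<open>K = {{}}\<close> the empty set would be a maximal cell, whereas a unimodular
  simplex is nonempty because its standard model contains the origin.\<close>

lemma unimodular_complex_imp_triangulation:
  fixes K :: "'a::euclidean_space set set"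
  assumes K: "unimodular_complex K" and ne: "K \<noteq> {{}}"
  shows "unimodular_triangulation ((\<lambda>A. convex hull A) ` K) (\<Union>A\<in>K. convex hull A)"
proof -
  let ?T = "(\<lambda>A. convex hull A) ` K"
  have "simplicial_complex ?T"
    unfolding simplicial_complex_def
  proof (intro conjI ballI allI impI)
    show "finite ?T" using K unimodular_complex_finite by blast
  next
    fix S assume "S \<in> ?T"
    then obtain A where A: "A \<in> K" "S = convex hull A" by blast
    then have "(int (card A) - 1) simplex S"
      using unimodular_complex_independent[OF K] unfolding simplex_def by force
    then show "\<exists>n. n simplex S" ..
  next
    fix F S assume "S \<in> ?T \<and> F face_of S"
    then obtain A where A: "A \<in> K" "F face_of convex hull A" by blast
    then obtain C where "C \<subseteq> A" "F = convex hull C"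
      using face_of_convex_hull_affine_independent[OF unimodular_complex_independent[OF K A(1)]] by blast
    then show "F \<in> ?T" using unimodular_complex_subset[OF K A(1)] by blast
  next
    fix S S' assume "S \<in> ?T \<and> S' \<in> ?T"
    then obtain A B where A: "A \<in> K" "S = convex hull A" and B: "B \<in> K" "S' = convex hull B" by blast
    show "S \<inter> S' face_of S"
      unfolding A B unimodular_complex_convex_hull_Int[OF K A(1) B(1)]
      using face_of_convex_hull_affine_independent[OF unimodular_complex_independent[OF K A(1)]] by blast
  qed
  moreover have "lattice_polytope T" if "T \<in> ?T" for T
    using that unimodular_complex_finite_simplex[OF K] unimodular_complex_integer_points[OF K]
    unfolding lattice_polytope_def by blast
  moreover have "unimodular_simplex T" if T: "T \<in> ?T" and max: "\<forall>T'\<in>?T. T \<subseteq> T' \<longrightarrow> T' = T" for T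
  proof -
    obtain A where A: "A \<in> K" "T = convex hull A" using T by blast
    obtain B where B: "B \<in> K" "B \<noteq> {}" using ne A(1) by blast
    have "A \<noteq> {}"
    proof
      assume "A = {}"
      then have "convex hull B = {}" using max A B(1) by auto
      then show False using B(2) by simp
    qed
    then show ?thesis using unimodular_complex_simplex[OF K A(1)] A(2) by blast
  qed
  ultimately show ?thesis unfolding unimodular_triangulation_def lattice_triangulation_def by blast
qed

section \<open>Chains of interlacing vertices\<close>

lemma finite_total_greatest:
  assumes "finite C" "C \<noteq> {}"
    and "\<forall>x\<in>C. \<forall>y\<in>C. r x y \<or> r y x"
    and "\<forall>x\<in>C. \<forall>y\<in>C. \<forall>z\<in>C. r x y \<longrightarrow> r y z \<longrightarrow> r x z"
  shows "\<exists>m\<in>C. \<forall>x\<in>C. r x m"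
  using assms
proof (induction C rule: finite_ne_induct)
  case (singleton x)
  then show ?case by blast
next
  case (insert x F)
  have "\<exists>m\<in>F. \<forall>x\<in>F. r x m"
    by (rule insert.IH) (use insert.prems in blast)+
  then obtain m where m: "m \<in> F" "\<forall>x\<in>F. r x m" by blast
  have xx: "r x x" using insert.prems(1) by blast
  show ?case
  proof (cases "r x m")
    case True
    then show ?thesis using m by blast
  next
    case False
    then have "r m x" using insert.prems(1) m by blast
    then have "\<forall>y\<in>F. r y x" using m insert.prems(2) by blast
    then show ?thesis using xx by blast
  qed
qed

text \<open>The strict lower set of \<open>p\<close> is the lower set of its own greatest element,
  so a nonempty strict partial sum is again a partial sum.\<close>

lemma finite_total_predecessor:
  assumes "finite A" "p \<in> A" "{x \<in> A. r x p \<and> x \<noteq> p} \<noteq> {}"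
    and tot: "\<forall>x\<in>A. \<forall>y\<in>A. r x y \<or> r y x"
    and trans: "\<forall>x\<in>A. \<forall>y\<in>A. \<forall>z\<in>A. r x y \<longrightarrow> r y z \<longrightarrow> r x z"
    and antisym: "\<forall>x\<in>A. \<forall>y\<in>A. r x y \<longrightarrow> r y x \<longrightarrow> x = y"
  shows "\<exists>m\<in>A. r m p \<and> m \<noteq> p \<and> {x \<in> A. r x p \<and> x \<noteq> p} = {x \<in> A. r x m}"
proof -
  let ?C = "{x \<in> A. r x p \<and> x \<noteq> p}"
  have fin: "finite ?C" using assms(1) by simp
  have "\<exists>m\<in>?C. \<forall>x\<in>?C. r x m"
  proof (rule finite_total_greatest[OF fin assms(3)])
    show "\<forall>x\<in>?C. \<forall>y\<in>?C. r x y \<or> r y x" using tot by blast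
    show "\<forall>x\<in>?C. \<forall>y\<in>?C. \<forall>z\<in>?C. r x y \<longrightarrow> r y z \<longrightarrow> r x z" using trans by blast
  qed
  then obtain m where m: "m \<in> A" "r m p" "m \<noteq> p" "\<And>x. x \<in> A \<Longrightarrow> r x p \<Longrightarrow> x \<noteq> p \<Longrightarrow> r x m"
    by blast
  have "r x p \<and> x \<noteq> p" if x: "x \<in> A" "r x m" for x
    using trans antisym assms(2) x m(1-3) by blast
  then have "?C = {x \<in> A. r x m}" using m(4) by blast
  then show ?thesis using m by blast
qed

text \<open>With \<alpha> read as lengths of intervals laid end to end, \<open>q\<close> is the
  interval that contains \<theta>. It is found as the least element whose partial sum exceeds
  \<theta>.\<close>

lemma finite_total_interval:
  fixes \<alpha> :: "'x \<Rightarrow> real"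
  assumes fin: "finite A"
    and tot: "\<forall>x\<in>A. \<forall>y\<in>A. r x y \<or> r y x"
    and trans: "\<forall>x\<in>A. \<forall>y\<in>A. \<forall>z\<in>A. r x y \<longrightarrow> r y z \<longrightarrow> r x z"
    and antisym: "\<forall>x\<in>A. \<forall>y\<in>A. r x y \<longrightarrow> r y x \<longrightarrow> x = y"
    and \<theta>: "0 \<le> \<theta>" "\<theta> < sum \<alpha> A"
  shows "\<exists>q\<in>A. sum \<alpha> {x \<in> A. r x q \<and> x \<noteq> q} \<le> \<theta> \<and> \<theta> < sum \<alpha> {x \<in> A. r x q}"
proof -
  have ne: "A \<noteq> {}" using \<theta> by auto
  obtain g where g: "g \<in> A" "\<forall>x\<in>A. r x g" using finite_total_greatest[where r = r, OF fin ne tot trans] by blast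
  let ?D = "{q \<in> A. \<theta> < sum \<alpha> {x \<in> A. r x q}}"
  have "{x \<in> A. r x g} = A" using g by blast
  then have neD: "?D \<noteq> {}" using g \<theta> by auto
  have finD: "finite ?D" using fin by simp
  \<comment> \<open>A greatest element for the reversed relation is a least one.\<close>
  have "\<exists>q\<in>?D. \<forall>x\<in>?D. r q x"
  proof (rule finite_total_greatest[OF finD neD])
    show "\<forall>x\<in>?D. \<forall>y\<in>?D. r y x \<or> r x y" using tot by blast
    show "\<forall>x\<in>?D. \<forall>y\<in>?D. \<forall>z\<in>?D. r y x \<longrightarrow> r z y \<longrightarrow> r z x" using trans by blast
  qed
  then obtain q where q: "q \<in> A" "\<theta> < sum \<alpha> {x \<in> A. r x q}" "\<forall>x\<in>?D. r q x" by blast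
  have "sum \<alpha> {x \<in> A. r x q \<and> x \<noteq> q} \<le> \<theta>"
  proof (rule ccontr)
    assume c: "\<not> ?thesis"
    have "{x \<in> A. r x q \<and> x \<noteq> q} \<noteq> {}"
    proof
      assume "{x \<in> A. r x q \<and> x \<noteq> q} = {}"
      then show False using c \<theta>(1) by (metis sum.empty)
    qed
    from finite_total_predecessor[where r = r, OF fin q(1) this tot trans antisym]
    obtain m where m: "m \<in> A" "r m q" "m \<noteq> q" "{x \<in> A. r x q \<and> x \<noteq> q} = {x \<in> A. r x m}" by blast
    then have "m \<in> ?D" using c by simp
    then show False using q antisym m by blast
  qed
  then show ?thesis using q by blast
qed

lemma sum_mult_add_of_bool:
  fixes a :: "'x \<Rightarrow> real"
  assumes "finite A"
  shows "(\<Sum>x\<in>A. a x * real (f x + of_bool (R x))) = (\<Sum>x\<in>A. a x * real (f x)) + sum a {x \<in> A. R x}"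
proof -
  have "(\<Sum>x\<in>A. a x * real (f x + of_bool (R x))) = (\<Sum>x\<in>A. a x * real (f x) + (if R x then a x else 0))"
    by (intro sum.cong) (auto simp: algebra_simps)
  then show ?thesis using assms by (simp add: sum.distrib sum.inter_filter)
qed

text \<open>
  A pair \<open>(v, N)\<close> encodes a lattice point over the vertex \<open>v\<close>, where \<open>n v\<close> stands for \<open>\<phi> v\<close>: it is \<open>v\<close>
  together with a sum of \<open>n v\<close> vertices of \<open>\<T>\<close>, and \<open>N j\<close> is the number of summands among the first \<open>j\<close>
  vertices in the enumeration. In these terms interlacing of sorted sequences becomes the last
  condition in \<open>chain\<close>, for every \<open>j\<close> separately. The order \<open>le\<close> is that of increasing \<open>\<theta>\<close>.
\<close>

locale staircase =
  fixes V :: "'v set" and key :: "'v \<Rightarrow> real" and n :: "'v \<Rightarrow> nat"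
  assumes finite_V: "finite V" and inj_key: "inj_on key V"
    and antitone: "v \<in> V \<Longrightarrow> v' \<in> V \<Longrightarrow> key v \<le> key v' \<Longrightarrow> n v' \<le> n v"
begin

definition le :: "'v \<times> ('w \<Rightarrow> nat) \<Rightarrow> 'v \<times> ('w \<Rightarrow> nat) \<Rightarrow> bool" where
  "le x y \<longleftrightarrow> key (fst x) \<le> key (fst y) \<and> (\<forall>w. snd y w \<le> snd x w)"

definition verts :: "('v \<times> ('w \<Rightarrow> nat)) set" where
  "verts = {x. fst x \<in> V \<and> (\<forall>w. snd x w \<le> n (fst x))}"

definition chain :: "('v \<times> ('w \<Rightarrow> nat)) set \<Rightarrow> bool" where
  "chain A \<longleftrightarrow> finite A \<and> A \<subseteq> verts \<and> (\<forall>x\<in>A. \<forall>y\<in>A. le x y \<or> le y x) \<and>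
     (\<forall>x\<in>A. \<forall>y\<in>A. le x y \<longrightarrow> (\<forall>w. snd x w \<le> Suc (snd y w) \<or> n (fst y) \<le> snd y w))"

lemma le_refl: "le x x"
  by (simp add: le_def)

lemma le_trans: "le x y \<Longrightarrow> le y z \<Longrightarrow> le x z"
  unfolding le_def by (meson order_trans)

lemma le_antisym: "x \<in> verts \<Longrightarrow> y \<in> verts \<Longrightarrow> le x y \<Longrightarrow> le y x \<Longrightarrow> x = y"
  using inj_key unfolding le_def verts_def
  by (auto intro!: prod_eqI ext simp: inj_on_def intro: antisym)

lemma chain_subset: "chain A \<Longrightarrow> B \<subseteq> A \<Longrightarrow> chain B"
  unfolding chain_def by (meson finite_subset order_trans subsetD)

lemma chain_finite: "chain A \<Longrightarrow> finite A"
  and chain_verts: "chain A \<Longrightarrow> x \<in> A \<Longrightarrow> x \<in> verts"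
  and chain_total: "chain A \<Longrightarrow> x \<in> A \<Longrightarrow> y \<in> A \<Longrightarrow> le x y \<or> le y x"
  and chain_interlace: "chain A \<Longrightarrow> x \<in> A \<Longrightarrow> y \<in> A \<Longrightarrow> le x y \<Longrightarrow> 
         snd x w \<le> Suc (snd y w) \<or> n (fst y) \<le> snd y w"
  unfolding chain_def by blast+

lemma vertsD: "x \<in> verts \<Longrightarrow> fst x \<in> V" "x \<in> verts \<Longrightarrow> snd x w \<le> n (fst x)"
  unfolding verts_def by auto

lemma chain_antisym: "chain A \<Longrightarrow> x \<in> A \<Longrightarrow> y \<in> A \<Longrightarrow> le x y \<Longrightarrow> le y x \<Longrightarrow> x = y"
  using chain_verts le_antisym by blast

lemma chain_order:
  assumes "chain A"
  shows "\<forall>x\<in>A. \<forall>y\<in>A. le x y \<or> le y x"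
    and "\<forall>x\<in>A. \<forall>y\<in>A. \<forall>z\<in>A. le x y \<longrightarrow> le y z \<longrightarrow> le x z"
    and "\<forall>x\<in>A. \<forall>y\<in>A. le x y \<longrightarrow> le y x \<longrightarrow> x = y"
  using assms chain_total le_trans chain_antisym by blast+

text \<open>Counts decrease along the order, so elements up to \<open>p\<close> have a count above
  \<open>k\<close>. For later elements, interlacing allows a drop by at most one unless the count is
  already full.\<close>

lemma chain_count_ge:
  assumes A: "chain A" "x \<in> A" "p \<in> A" and k: "k < snd p w"
  shows "min k (n (fst x)) + of_bool (le x p) \<le> snd x w"
proof (cases "le x p")
  case True
  then have "snd p w \<le> snd x w" by (simp add: le_def)
  then show ?thesis using k True by simp
next
  case False
  then have "le p x" using A chain_total by blast
  then show ?thesis using chain_interlace[OF A(1,3,2), of w] k False by auto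
qed

text \<open>The upper counterpart of \<open>chain_count_ge\<close>. Elements before \<open>p\<close>
  exceed its count by at most one, and for them \<open>min k (n (fst x))\<close> is \<open>k\<close>
  because \<open>n\<close> decreases along the order.\<close>

lemma chain_count_le:
  assumes A: "chain A" "x \<in> A" "p \<in> A" and k: "snd p w \<le> k" "k < n (fst p)"
  shows "snd x w \<le> min k (n (fst x)) + of_bool (le x p \<and> x \<noteq> p)"
proof (cases "le x p \<and> x \<noteq> p")
  case True
  then have "n (fst p) \<le> n (fst x)" 
    using antitone[OF vertsD(1)[OF chain_verts[OF A(1,2)]] vertsD(1)[OF chain_verts[OF A(1,3)]]]
    by (simp add: le_def)
  then show ?thesis using chain_interlace[OF A(1-3), of w] k True by auto
next
  case False
  then have "le p x" using A chain_total le_refl by blast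
  then have "snd x w \<le> snd p w" by (simp add: le_def)
  then show ?thesis using k vertsD(2)[OF chain_verts[OF A(1,2)], of w] by simp
qed

text \<open>Here \<open>p\<close> is the element whose interval contains \<theta>. The elements of
  key at most \<open>t\<close> form an initial segment of the chain, which contains \<open>p\<close>
  exactly when its mass exceeds \<theta>.\<close>

lemma chain_interval_key:
  fixes \<alpha> :: "'v \<times> ('w \<Rightarrow> nat) \<Rightarrow> real"
  assumes A: "chain A" "p \<in> A" and pos: "\<forall>x\<in>A. 0 < \<alpha> x"
    and \<theta>: "sum \<alpha> {x \<in> A. le x p \<and> x \<noteq> p} \<le> \<theta>" "\<theta> < sum \<alpha> {x \<in> A. le x p}"
  shows "key (fst p) \<le> t \<longleftrightarrow> \<theta> < sum \<alpha> {x \<in> A. key (fst x) \<le> t}"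
proof
  have fin: "finite A" using A chain_finite by blast
  have nn: "0 \<le> \<alpha> x" if "x \<in> A" for x using pos that by (simp add: less_imp_le)
  {
    assume "key (fst p) \<le> t"
    then have "{x \<in> A. le x p} \<subseteq> {x \<in> A. key (fst x) \<le> t}" by (auto simp: le_def)
    then have "sum \<alpha> {x \<in> A. le x p} \<le> sum \<alpha> {x \<in> A. key (fst x) \<le> t}"
      using fin nn by (intro sum_mono2) auto
    then show "\<theta> < sum \<alpha> {x \<in> A. key (fst x) \<le> t}" using \<theta> by simp
  }
  assume *: "\<theta> < sum \<alpha> {x \<in> A. key (fst x) \<le> t}"
  show "key (fst p) \<le> t"
  proof (rule ccontr)
    assume c: "\<not> ?thesis"
    have "{x \<in> A. key (fst x) \<le> t} \<subseteq> {x \<in> A. le x p \<and> x \<noteq> p}"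
    proof
      fix x assume x: "x \<in> {x \<in> A. key (fst x) \<le> t}"
      then have "\<not> le p x" "x \<noteq> p" using c by (auto simp: le_def)
      then show "x \<in> {x \<in> A. le x p \<and> x \<noteq> p}" using chain_total[OF A(1,2), of x] x by blast
    qed
    then have "sum \<alpha> {x \<in> A. key (fst x) \<le> t} \<le> sum \<alpha> {x \<in> A. le x p \<and> x \<noteq> p}"
      using fin nn by (intro sum_mono2) auto
    then show False using * \<theta> by simp
  qed
qed

text \<open>The bounds of \<open>chain_count_ge\<close> and \<open>chain_count_le\<close>, summed
  over the chain, exceed the sum of the minima by the mass up to \<open>p\<close> and the mass
  strictly before \<open>p\<close>, respectively; \<theta> lies between these two masses.\<close>

lemma chain_interval_count:
  fixes \<alpha> :: "'v \<times> ('w \<Rightarrow> nat) \<Rightarrow> real"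
  assumes A: "chain A" "p \<in> A" and pos: "\<forall>x\<in>A. 0 < \<alpha> x"
    and \<theta>: "sum \<alpha> {x \<in> A. le x p \<and> x \<noteq> p} \<le> \<theta>" "\<theta> < sum \<alpha> {x \<in> A. le x p}"
    and k: "k < n (fst p)"
  shows "k < snd p w \<longleftrightarrow>
    \<theta> + (\<Sum>x\<in>A. \<alpha> x * real (min k (n (fst x)))) < (\<Sum>x\<in>A. \<alpha> x * real (snd x w))"
proof
  have fin: "finite A" using A chain_finite by blast
  have split: "(\<Sum>x\<in>A. \<alpha> x * real (min k (n (fst x)) + of_bool (R x))) =
      (\<Sum>x\<in>A. \<alpha> x * real (min k (n (fst x)))) + sum \<alpha> {x \<in> A. R x}" for R
    by (rule sum_mult_add_of_bool[OF fin])
  have mono: "(\<Sum>x\<in>A. \<alpha> x * real (f x)) \<le> (\<Sum>x\<in>A. \<alpha> x * real (g x))" if "\<And>x. x \<in> A \<Longrightarrow> f x \<le> g x" for f g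
    using that pos by (intro sum_mono mult_left_mono) (auto intro: less_imp_le)
  {
    assume "k < snd p w"
    then show "\<theta> + (\<Sum>x\<in>A. \<alpha> x * real (min k (n (fst x)))) < (\<Sum>x\<in>A. \<alpha> x * real (snd x w))"
      using mono[of "\<lambda>x. min k (n (fst x)) + of_bool (le x p)" "\<lambda>x. snd x w"] chain_count_ge[OF A(1) _ A(2)]
        \<theta>(2) split[of "\<lambda>x. le x p"] by simp
  }
  assume *: "\<theta> + (\<Sum>x\<in>A. \<alpha> x * real (min k (n (fst x)))) < (\<Sum>x\<in>A. \<alpha> x * real (snd x w))"
  show "k < snd p w"
  proof (rule ccontr)
    assume "\<not> ?thesis"
    then have "snd p w \<le> k" by simp
    then show False
      using mono[of "\<lambda>x. snd x w" "\<lambda>x. min k (n (fst x)) + of_bool (le x p \<and> x \<noteq> p)"] chain_count_le[OF A(1) _ A(2) _ k]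
        \<theta>(1) split[of "\<lambda>x. le x p \<and> x \<noteq> p"] * by simp
  qed
qed

text \<open>
  By the two preceding lemmas the element of a chain at position \<open>\<theta>\<close> depends only on sums that are
  determined by the point which the chain represents.
\<close>

lemma chain_unique_subset:
  fixes \<alpha> \<beta> :: "'v \<times> ('w \<Rightarrow> nat) \<Rightarrow> real"
  assumes A: "chain A" and B: "chain B"
    and pos: "\<forall>x\<in>A. 0 < \<alpha> x" "\<forall>x\<in>B. 0 < \<beta> x"
    and tot: "sum \<alpha> A = sum \<beta> B"
    and keys: "\<And>t. sum \<alpha> {x \<in> A. key (fst x) \<le> t} = sum \<beta> {x \<in> B. key (fst x) \<le> t}"
    and mins: "\<And>k. (\<Sum>x\<in>A. \<alpha> x * real (min k (n (fst x)))) = (\<Sum>x\<in>B. \<beta> x * real (min k (n (fst x))))"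
    and cnts: "\<And>w. (\<Sum>x\<in>A. \<alpha> x * real (snd x w)) = (\<Sum>x\<in>B. \<beta> x * real (snd x w))"
  shows "A \<subseteq> B"
proof
  fix p assume p: "p \<in> A"
  \<comment> \<open>The left end of the interval of \<open>p\<close>. The element \<open>q\<close>
    of \<open>B\<close> whose interval contains it will turn out to be \<open>p\<close>.\<close>
  let ?\<theta> = "sum \<alpha> {x \<in> A. le x p \<and> x \<noteq> p}"
  have fin: "finite A" "finite B" using A B chain_finite by blast+
  have "{x \<in> A. le x p} = insert p {x \<in> A. le x p \<and> x \<noteq> p}" using p le_refl by blast
  then have lt: "?\<theta> < sum \<alpha> {x \<in> A. le x p}" using fin pos(1) p by simp
  also have "\<dots> \<le> sum \<alpha> A" using fin pos by (intro sum_mono2) (auto intro: less_imp_le)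
  finally have "?\<theta> < sum \<beta> B" using tot by simp
  moreover have "0 \<le> ?\<theta>" using pos by (intro sum_nonneg) (auto intro: less_imp_le)
  ultimately have "\<exists>q\<in>B. sum \<beta> {x \<in> B. le x q \<and> x \<noteq> q} \<le> ?\<theta> \<and> ?\<theta> < sum \<beta> {x \<in> B. le x q}"
    by (intro finite_total_interval[OF fin(2)] chain_order[OF B])
  then obtain q where q: "q \<in> B" "sum \<beta> {x \<in> B. le x q \<and> x \<noteq> q} \<le> ?\<theta>" "?\<theta> < sum \<beta> {x \<in> B. le x q}"
    by blast
  note kp = chain_interval_key[OF A p pos(1) order_refl lt] chain_interval_key[OF B q(1) pos(2) q(2,3)]
  have "key (fst p) \<le> t \<longleftrightarrow> key (fst q) \<le> t" for t
    using kp(1)[of t] kp(2)[of t] keys[of t] by simp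
  then have "key (fst p) = key (fst q)" by (meson order_antisym order_refl)
  then have eq: "fst p = fst q"
    using inj_key vertsD(1)[OF chain_verts[OF A p]] vertsD(1)[OF chain_verts[OF B q(1)]] by (auto simp: inj_on_def)
  have "snd p w = snd q w" for w
  proof -
    have iff: "k < snd p w \<longleftrightarrow> k < snd q w" if "k < n (fst p)" for k
      using chain_interval_count[OF A p pos(1) order_refl lt that, of w]
        chain_interval_count[OF B q(1) pos(2) q(2,3), of k w] that eq unfolding mins cnts by simp
    have "snd p w \<le> n (fst p)" "snd q w \<le> n (fst p)"
      using vertsD(2)[OF chain_verts[OF A p]] vertsD(2)[OF chain_verts[OF B q(1)]] eq by auto
    \<comment> \<open>If the counts differ, the smaller one is a threshold below
      \<open>n (fst p)\<close> that separates them.\<close>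
    then show ?thesis using iff[of "snd p w"] iff[of "snd q w"] 
      by (cases "snd p w" "snd q w" rule: linorder_cases) auto
  qed
  then have "p = q" using eq by (auto intro: prod_eqI)
  then show "p \<in> B" using q by simp
qed

text \<open>
  If \<open>p\<close> and its successor \<open>q\<close> lie over different vertices, the partial sum up to \<open>p\<close> is one of the sums
  by \<open>key\<close>. Otherwise \<open>q\<close> drops a count from \<open>k + 1\<close> to \<open>k\<close> at some \<open>w\<close>; then the count at \<open>w\<close> of every
  chain element \<open>x\<close> is \<open>min k (n (fst x))\<close>, increased by one exactly when \<open>x\<close> is at most \<open>p\<close>.
\<close>

lemma chain_below_Ints:
  fixes c :: "'v \<times> ('w \<Rightarrow> nat) \<Rightarrow> real"
  assumes A: "chain A" and p: "p \<in> A"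
    and keys: "\<And>t. sum c {x \<in> A. key (fst x) \<le> t} \<in> \<int>"
    and mins: "\<And>k. (\<Sum>x\<in>A. c x * real (min k (n (fst x)))) \<in> \<int>"
    and cnts: "\<And>w. (\<Sum>x\<in>A. c x * real (snd x w)) \<in> \<int>"
  shows "sum c {x \<in> A. le x p} \<in> \<int>"
proof -
  let ?U = "{x \<in> A. \<not> le x p}"
  have fin: "finite A" using A chain_finite by blast
  have le_pU: "le p x" if "x \<in> ?U" for x using that chain_total[OF A p] by blast
  show ?thesis
  proof (cases "\<exists>q\<in>?U. key (fst q) \<le> key (fst p)")
    case False
    then have "{x \<in> A. le x p} = {x \<in> A. key (fst x) \<le> key (fst p)}"
    proof (intro equalityI subsetI)
      fix x assume "x \<in> {x \<in> A. key (fst x) \<le> key (fst p)}"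
      then show "x \<in> {x \<in> A. le x p}" using False by blast
    qed (auto simp: le_def)
    then show ?thesis using keys by simp
  next
    case True
    then have ne: "?U \<noteq> {}" by blast
    have finU: "finite ?U" using fin by simp
    \<comment> \<open>The successor of \<open>p\<close>: a greatest element of \<open>?U\<close> for
      the reversed order.\<close>
    have "\<exists>q\<in>?U. \<forall>x\<in>?U. le q x"
      by (rule finite_total_greatest[OF finU ne]) (use chain_order(1,2)[OF A] in blast)+
    then obtain q where q: "q \<in> A" "\<not> le q p" "\<And>x. x \<in> A \<Longrightarrow> \<not> le x p \<Longrightarrow> le q x" by blast
    have pq: "le p q" using q le_pU by blast
    have "key (fst q) \<le> key (fst p)" using True q(3) unfolding le_def by fastforce
    then have "key (fst q) = key (fst p)" using pq unfolding le_def by simp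
    then have eq: "fst q = fst p"
      using inj_key vertsD(1)[OF chain_verts[OF A p]] vertsD(1)[OF chain_verts[OF A q(1)]] by (auto simp: inj_on_def)
    then obtain w where w: "snd q w < snd p w" using q(2) by (auto simp: le_def not_le)
    let ?k = "snd q w"
    have kn: "?k < n (fst q)" using w vertsD(2)[OF chain_verts[OF A p], of w] eq by simp
    \<comment> \<open>The lower bound at \<open>p\<close> and the upper bound at \<open>q\<close>
      meet, because the elements strictly before \<open>q\<close> are those up to
      \<open>p\<close>.\<close>
    have cnt: "snd x w = min ?k (n (fst x)) + of_bool (le x p)" if x: "x \<in> A" for x
    proof (rule order_antisym)
      have "le x q \<and> x \<noteq> q \<longrightarrow> le x p" using q x chain_antisym[OF A] by blast
      then show "snd x w \<le> min ?k (n (fst x)) + of_bool (le x p)"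
        using chain_count_le[OF A x q(1) order_refl kn] by (auto simp: of_bool_def split: if_splits)
      show "min ?k (n (fst x)) + of_bool (le x p) \<le> snd x w" by (rule chain_count_ge[OF A x p w])
    qed
    have "(\<Sum>x\<in>A. c x * real (snd x w)) = (\<Sum>x\<in>A. c x * real (min ?k (n (fst x)) + of_bool (le x p)))"
      using cnt by (intro sum.cong) auto
    also have "\<dots> = (\<Sum>x\<in>A. c x * real (min ?k (n (fst x)))) + sum c {x \<in> A. le x p}"
      by (rule sum_mult_add_of_bool[OF fin])
    finally have "sum c {x \<in> A. le x p} =
        (\<Sum>x\<in>A. c x * real (snd x w)) - (\<Sum>x\<in>A. c x * real (min ?k (n (fst x))))" by simp
    then show ?thesis using cnts[of w] mins[of ?k] by (simp only: Ints_diff)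
  qed
qed

text \<open>A coefficient is the difference of two consecutive partial sums, which are integers by
  \<open>chain_below_Ints\<close>; before the least element the sum is empty.\<close>

lemma chain_Ints:
  fixes c :: "'v \<times> ('w \<Rightarrow> nat) \<Rightarrow> real"
  assumes A: "chain A" and p: "p \<in> A"
    and keys: "\<And>t. sum c {x \<in> A. key (fst x) \<le> t} \<in> \<int>"
    and mins: "\<And>k. (\<Sum>x\<in>A. c x * real (min k (n (fst x)))) \<in> \<int>"
    and cnts: "\<And>w. (\<Sum>x\<in>A. c x * real (snd x w)) \<in> \<int>"
  shows "c p \<in> \<int>"
proof -
  have fin: "finite A" using A chain_finite by blast
  have below: "sum c {x \<in> A. le x q} \<in> \<int>" if "q \<in> A" for q
    using chain_below_Ints[OF A that] keys mins cnts by blast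
  have "sum c {x \<in> A. le x p \<and> x \<noteq> p} \<in> \<int>"
  proof (cases "{x \<in> A. le x p \<and> x \<noteq> p} = {}")
    case False
    from finite_total_predecessor[where r = le, OF fin p False chain_order[OF A]]
    obtain m where "m \<in> A" "{x \<in> A. le x p \<and> x \<noteq> p} = {x \<in> A. le x m}" by blast
    then show ?thesis using below by simp
  qed (simp only: sum.empty Ints_0)
  moreover have "{x \<in> A. le x p} = insert p {x \<in> A. le x p \<and> x \<noteq> p}" using p le_refl by blast
  then have "sum c {x \<in> A. le x p} = c p + sum c {x \<in> A. le x p \<and> x \<noteq> p}" using fin by simp
  ultimately show ?thesis using Ints_diff[OF below[OF p]] by fastforce
qed

end

section \<open>Every weight is carried by a chain\<close>

text \<open>Allows the cardinality in \<open>count\<close> to be compared with a threshold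
  \<open>k\<close> by testing membership of \<open>k\<close>.\<close>

lemma initial_segment_iff_less_card:
  fixes D :: "nat set"
  assumes "finite D" "\<And>j k. k \<in> D \<Longrightarrow> j \<le> k \<Longrightarrow> j \<in> D"
  shows "k \<in> D \<longleftrightarrow> k < card D"
proof
  assume "k \<in> D"
  then have "{..k} \<subseteq> D" using assms(2) by auto
  from card_mono[OF assms(1) this] show "k < card D" by simp
next
  assume *: "k < card D"
  show "k \<in> D"
  proof (rule ccontr)
    assume "k \<notin> D"
    then have "D \<subseteq> {..<k}" using assms(2) by (meson lessThan_iff not_le subsetI)
    from card_mono[OF _ this] show False using * by simp
  qed
qed

text \<open>\<mu> holds the barycentric coordinates of \<open>a\<close>, and \<Lambda> the positions
  of cuts in the interval of length \<phi> a, which is the bound in \<open>\<Lambda>_le\<close>. The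
  index type of the cuts may be infinite; finiteness is asked of the range, since counts depend on
  \<open>w\<close> only through \<open>\<Lambda> w\<close>.\<close>

locale staircase_weights = staircase V key n
  for V :: "'v set" and key :: "'v \<Rightarrow> real" and n :: "'v \<Rightarrow> nat" +
  fixes \<mu> :: "'v \<Rightarrow> real" and \<Lambda> :: "'w \<Rightarrow> real"
  assumes \<mu>_nonneg: "v \<in> V \<Longrightarrow> 0 \<le> \<mu> v" and sum_\<mu>: "sum \<mu> V = 1"
    and \<Lambda>_nonneg: "0 \<le> \<Lambda> w" and \<Lambda>_le: "\<Lambda> w \<le> (\<Sum>v\<in>V. \<mu> v * real (n v))"
    and finite_range_\<Lambda>: "finite (range \<Lambda>)"
begin

text \<open>The vertices divide [0, 1) in the order of \<open>key\<close>; the interval of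
  \<open>v\<close> runs from \<open>before v\<close> to \<open>cumulative v\<close>.\<close>

definition cumulative where "cumulative v = sum \<mu> {x \<in> V. key x \<le> key v}"
definition before :: "'v \<Rightarrow> real" where "before v = sum \<mu> {x \<in> V. key x < key v}"
definition layer where "layer k = sum \<mu> {v \<in> V. k < n v}"
text \<open>The left end of layer \<open>k\<close> in the interval of length \<phi> a:
  \<open>min k (n v)\<close> is the number of layers below \<open>k\<close> to which
  \<open>v\<close> contributes.\<close>

definition start where "start k = (\<Sum>v\<in>V. \<mu> v * real (min k (n v)))"
text \<open>The length of the part of layer \<open>k\<close> to the left of position
  \<open>l\<close>, negative if \<open>l\<close> lies before the layer.\<close>

definition cut where "cut k l = min (layer k) (l - start k)"
definition vertex_at where "vertex_at \<theta> = (SOME v. v \<in> V \<and> before v \<le> \<theta> \<and> \<theta> < cumulative v)"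
text \<open>For nonnegative \<theta>, the number of layers that have a point at height \<theta> and
  have it to the left of position \<open>l\<close>.\<close>

definition count where "count \<theta> l = card {k. \<theta> < cut k l}"
definition vert :: "real \<Rightarrow> 'v \<times> ('w \<Rightarrow> nat)" where "vert \<theta> = (vertex_at \<theta>, \<lambda>w. count \<theta> (\<Lambda> w))"

section \<open>The vertex and the counts selected at a height\<close>

lemma vertex_at:
  assumes "0 \<le> \<theta>" "\<theta> < 1"
  shows "vertex_at \<theta> \<in> V" "before (vertex_at \<theta>) \<le> \<theta>" "\<theta> < cumulative (vertex_at \<theta>)"
proof -
  have "\<exists>q\<in>V. sum \<mu> {x \<in> V. key x \<le> key q \<and> x \<noteq> q} \<le> \<theta> \<and> \<theta> < sum \<mu> {x \<in> V. key x \<le> key q}"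
    by (rule finite_total_interval[OF finite_V])
      (use assms sum_\<mu> inj_key in \<open>auto simp: inj_on_def\<close>)
  then obtain q where q: "q \<in> V" "sum \<mu> {x \<in> V. key x \<le> key q \<and> x \<noteq> q} \<le> \<theta>"
    "\<theta> < sum \<mu> {x \<in> V. key x \<le> key q}" by blast
  have "{x \<in> V. key x \<le> key q \<and> x \<noteq> q} = {x \<in> V. key x < key q}"
    using inj_key q(1) by (force simp: inj_on_def)
  then have "q \<in> V \<and> before q \<le> \<theta> \<and> \<theta> < cumulative q" using q unfolding before_def cumulative_def by simp
  then have "vertex_at \<theta> \<in> V \<and> before (vertex_at \<theta>) \<le> \<theta> \<and> \<theta> < cumulative (vertex_at \<theta>)" unfolding vertex_at_def by (rule someI)
  then show "vertex_at \<theta> \<in> V" "before (vertex_at \<theta>) \<le> \<theta>" "\<theta> < cumulative (vertex_at \<theta>)" by auto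
qed

lemma sum_\<mu>_mono: "A \<subseteq> B \<Longrightarrow> B \<subseteq> V \<Longrightarrow> sum \<mu> A \<le> sum \<mu> B"
  using finite_subset[OF _ finite_V] \<mu>_nonneg by (intro sum_mono2) auto

lemma key_mono:
  assumes "before v \<le> \<theta>" "\<theta> \<le> \<theta>'" "\<theta>' < cumulative v'"
  shows "key v \<le> key v'"
proof (rule ccontr)
  assume "\<not> ?thesis"
  then have "cumulative v' \<le> before v" unfolding cumulative_def before_def by (intro sum_\<mu>_mono) auto
  then show False using assms by simp
qed

lemma start_Suc: "start (Suc k) = start k + layer k"
proof -
  have "start (Suc k) = (\<Sum>v\<in>V. \<mu> v * real (min k (n v) + of_bool (k < n v)))"
    unfolding start_def by (intro sum.cong) auto
  then show ?thesis unfolding sum_mult_add_of_bool[OF finite_V] start_def layer_def .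
qed

lemma layer_nonneg: "0 \<le> layer k"
  unfolding layer_def using \<mu>_nonneg by (intro sum_nonneg) auto

lemma layer_le_1: "layer k \<le> 1"
  unfolding layer_def sum_\<mu>[symmetric] by (rule sum_\<mu>_mono) auto

lemma layer_antimono: "j \<le> k \<Longrightarrow> layer k \<le> layer j"
  unfolding layer_def by (rule sum_\<mu>_mono) auto

lemma start_mono: "j \<le> k \<Longrightarrow> start j \<le> start k"
  by (induction rule: dec_induct) (use start_Suc layer_nonneg in \<open>auto intro: order_trans\<close>)

lemma cut_antimono: "j \<le> k \<Longrightarrow> cut k l \<le> cut j l"
  unfolding cut_def using layer_antimono[of j k] start_mono[of j k] by linarith

text \<open>Serves only as a common bound of the \<open>n v\<close>: layers from there on have
  length zero.\<close>

definition max_count where "max_count = sum n V"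

lemma n_le_max_count: "v \<in> V \<Longrightarrow> n v \<le> max_count"
  unfolding max_count_def using finite_V by (meson member_le_sum zero_le)

lemma layer_max_count: "max_count \<le> k \<Longrightarrow> layer k = 0"
proof -
  assume "max_count \<le> k"
  then have "{v \<in> V. k < n v} = {}" using n_le_max_count by fastforce
  then show ?thesis unfolding layer_def by (metis sum.empty)
qed

lemma start_max_count: "start max_count = (\<Sum>v\<in>V. \<mu> v * real (n v))"
  unfolding start_def using n_le_max_count by (intro sum.cong) (auto simp: min_absorb2)

lemma start_0: "start 0 = 0"
  by (simp add: start_def)

lemma less_cut_imp_less_max_count: "0 \<le> \<theta> \<Longrightarrow> \<theta> < cut k l \<Longrightarrow> k < max_count"
  using layer_max_count[of k] unfolding cut_def by (metis leI min_less_iff_conj order_less_le_trans less_irrefl)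

text \<open>Cuts decrease in \<open>k\<close>, so the counted layers form an initial segment. It is
  finite because a nonnegative \<theta> is never below the cut of an empty layer.\<close>

lemma less_count_iff: "0 \<le> \<theta> \<Longrightarrow> k < count \<theta> l \<longleftrightarrow> \<theta> < cut k l"
proof -
  assume \<theta>: "0 \<le> \<theta>"
  have "finite {k. \<theta> < cut k l}"
    by (rule finite_subset[of _ "{..<max_count}"]) (use less_cut_imp_less_max_count[OF \<theta>] in auto)
  from initial_segment_iff_less_card[OF this, of k] show ?thesis
    unfolding count_def using cut_antimono by (metis (no_types, lifting) mem_Collect_eq order_less_le_trans)
qed

text \<open>Since \<open>n\<close> decreases as \<open>key\<close> grows, the vertices with
  \<open>n v\<close> above \<open>k\<close> come first and fill exactly the heights below
  \<open>layer k\<close>.\<close>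

lemma less_n_at_iff:
  assumes "0 \<le> \<theta>" "\<theta> < 1"
  shows "k < n (vertex_at \<theta>) \<longleftrightarrow> \<theta> < layer k"
proof
  assume k: "k < n (vertex_at \<theta>)"
  have "cumulative (vertex_at \<theta>) \<le> layer k"
    unfolding cumulative_def layer_def using antitone[OF _ vertex_at(1)[OF assms]] k by (intro sum_\<mu>_mono) force+
  then show "\<theta> < layer k" using vertex_at(3)[OF assms] by simp
next
  assume *: "\<theta> < layer k"
  show "k < n (vertex_at \<theta>)"
  proof (rule ccontr)
    assume k: "\<not> ?thesis"
    have "layer k \<le> before (vertex_at \<theta>)"
      unfolding before_def layer_def
    proof (rule sum_\<mu>_mono)
      show "{v \<in> V. k < n v} \<subseteq> {x \<in> V. key x < key (vertex_at \<theta>)}"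
      proof
        fix v assume v: "v \<in> {v \<in> V. k < n v}"
        then have "\<not> key (vertex_at \<theta>) \<le> key v" using antitone[OF vertex_at(1)[OF assms], of v] k by auto
        then show "v \<in> {x \<in> V. key x < key (vertex_at \<theta>)}" using v by simp
      qed
    qed auto
    then show False using * vertex_at(2)[OF assms] by simp
  qed
qed

text \<open>A cut never exceeds its layer, so a counted layer reaches beyond \<theta>, and such
  layers are those below \<open>n (vertex_at \<theta>)\<close>.\<close>

lemma count_le_n: 
  assumes "0 \<le> \<theta>" "\<theta> < 1"
  shows "count \<theta> l \<le> n (vertex_at \<theta>)"
proof (rule ccontr)
  assume "\<not> ?thesis"
  then have "\<theta> < cut (n (vertex_at \<theta>)) l" by (simp add: less_count_iff[OF assms(1), symmetric])
  then have "n (vertex_at \<theta>) < n (vertex_at \<theta>)" unfolding less_n_at_iff[OF assms] cut_def by simp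
  then show False by simp
qed

lemma vert_verts: "0 \<le> \<theta> \<Longrightarrow> \<theta> < 1 \<Longrightarrow> vert \<theta> \<in> verts"
  unfolding vert_def verts_def using vertex_at(1) count_le_n by simp

lemma count_antimono: "0 \<le> \<theta> \<Longrightarrow> \<theta> \<le> \<theta>' \<Longrightarrow> count \<theta>' l \<le> count \<theta> l"
  using less_count_iff[of \<theta> "count \<theta> l" l] less_count_iff[of \<theta>' "count \<theta> l" l]
  by (meson less_irrefl linorder_not_less order.trans order_le_less_trans)

lemma count_mono: 
  assumes "0 \<le> \<theta>" "l \<le> l'"
  shows "count \<theta> l \<le> count \<theta> l'"
proof (rule ccontr)
  assume "\<not> ?thesis"
  then have "\<theta> < cut (count \<theta> l') l" by (simp add: less_count_iff[OF assms(1), symmetric])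
  then have "\<theta> < cut (count \<theta> l') l'" using assms(2) unfolding cut_def by simp
  then show False using less_count_iff[OF assms(1)] by blast
qed

section \<open>The vertices selected at all heights form a chain\<close>

lemma le_vert: 
  assumes "0 \<le> \<theta>" "\<theta> \<le> \<theta>'" "\<theta>' < 1"
  shows "le (vert \<theta>) (vert \<theta>')"
  unfolding le_def vert_def using key_mono[OF vertex_at(2) assms(2) vertex_at(3)] count_antimono assms by auto

text \<open>If layer \<open>k\<close> reaches beyond \<theta>' but its cut does not, then
  \<open>l\<close> lies inside or before layer \<open>k\<close>. The cut of layer
  \<open>k + 1\<close> is then negative, so that layer is not counted at any height.\<close>

lemma interlace_vert:
  assumes "0 \<le> \<theta>" "\<theta> \<le> \<theta>'" "\<theta>' < 1"
  shows "count \<theta> l \<le> Suc (count \<theta>' l) \<or> n (vertex_at \<theta>') \<le> count \<theta>' l"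
proof (rule disjCI)
  let ?k = "count \<theta>' l"
  assume "\<not> n (vertex_at \<theta>') \<le> ?k"
  then have "\<theta>' < layer ?k" using less_n_at_iff[of \<theta>' ?k] assms by simp
  moreover have "\<not> \<theta>' < cut ?k l" using less_count_iff[of \<theta>' ?k l] assms by simp
  ultimately have "\<not> \<theta> < cut (Suc ?k) l" using assms unfolding cut_def start_Suc by simp
  then show "count \<theta> l \<le> Suc ?k" using less_count_iff[of \<theta> "Suc ?k" l] assms by simp
qed

text \<open>Counts are bounded by \<open>max_count\<close> and depend on \<open>w\<close> only
  through the finitely many values of \<Lambda>.\<close>

lemma finite_vert: "finite (vert ` {0..<1})"
proof (rule finite_subset)
  show "vert ` {0..<1} \<subseteq> V \<times> (\<lambda>f w. f (\<Lambda> w)) ` (range \<Lambda> \<rightarrow>\<^sub>E {..max_count})"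
  proof
    fix x assume "x \<in> vert ` {0..<1}"
    then obtain \<theta> where \<theta>: "x = vert \<theta>" "0 \<le> \<theta>" "\<theta> < 1" by auto
    have "count \<theta> l \<le> max_count" for l
      using count_le_n[OF \<theta>(2,3), of l] n_le_max_count[OF vertex_at(1)[OF \<theta>(2,3)]] by simp
    then have "restrict (count \<theta>) (range \<Lambda>) \<in> range \<Lambda> \<rightarrow>\<^sub>E {..max_count}" by auto
    moreover have "snd x = (\<lambda>w. restrict (count \<theta>) (range \<Lambda>) (\<Lambda> w))" by (simp add: \<theta>(1) vert_def)
    ultimately have "snd x \<in> (\<lambda>f w. f (\<Lambda> w)) ` (range \<Lambda> \<rightarrow>\<^sub>E {..max_count})" by blast
    moreover have "fst x \<in> V" using vertex_at(1)[OF \<theta>(2,3)] by (simp add: \<theta>(1) vert_def)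
    ultimately show "x \<in> V \<times> (\<lambda>f w. f (\<Lambda> w)) ` (range \<Lambda> \<rightarrow>\<^sub>E {..max_count})" by (simp add: mem_Times_iff)
  qed
  show "finite (V \<times> (\<lambda>f w. f (\<Lambda> w)) ` (range \<Lambda> \<rightarrow>\<^sub>E {..max_count}) :: ('v \<times> ('w \<Rightarrow> nat)) set)"
    by (intro finite_cartesian_product finite_V finite_imageI[OF finite_PiE[OF finite_range_\<Lambda>]]) simp
qed

lemma chain_vert: "chain (vert ` {0..<1})"
  unfolding chain_def
proof (intro conjI ballI impI allI)
  show "finite (vert ` {0..<1})" by (rule finite_vert)
  show "vert ` {0..<1} \<subseteq> verts" using vert_verts by auto
next
  fix x y assume "x \<in> vert ` {0..<1}" "y \<in> vert ` {0..<1}"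
  then obtain \<theta> \<theta>' where \<theta>: "x = vert \<theta>" "0 \<le> \<theta>" "\<theta> < 1" "y = vert \<theta>'" "0 \<le> \<theta>'" "\<theta>' < 1" by auto
  show "le x y \<or> le y x"
    using \<theta> le_vert[of \<theta> \<theta>'] le_vert[of \<theta>' \<theta>] by (cases "\<theta> \<le> \<theta>'") auto
  fix w assume le: "le x y"
  show "snd x w \<le> Suc (snd y w) \<or> n (fst y) \<le> snd y w"
  proof (cases "\<theta> \<le> \<theta>'")
    case True
    then show ?thesis using interlace_vert[of \<theta> \<theta>' "\<Lambda> w"] \<theta> by (simp add: vert_def)
  next
    \<comment> \<open>The elements are then comparable in both directions and coincide.\<close>
    case False
    then have "le y x" using \<theta> le_vert[of \<theta>' \<theta>] by simp
    then have "x = y" using le le_antisym vert_verts \<theta> by blast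
    then show ?thesis by simp
  qed
qed

section \<open>Weights as lengths of sets of heights\<close>

definition weight where "weight x = measure lborel {\<theta> \<in> {0..<1}. vert \<theta> = x}"

text \<open>By monotonicity and antisymmetry the fibres of \<open>vert\<close> are intervals, hence
  measurable; there are finitely many, so finite additivity of the measure applies.\<close>

lemma sum_weight: "sum weight {x \<in> vert ` {0..<1}. R x} = measure lborel {\<theta> \<in> {0..<1}. R (vert \<theta>)}"
proof -
  let ?I = "{x \<in> vert ` {0..<1}. R x}"
  let ?D = "\<lambda>x. {\<theta> \<in> {0..<1}. vert \<theta> = x}"
  have "measure lborel (\<Union>x\<in>?I. ?D x) = (\<Sum>x\<in>?I. measure lborel (?D x))"
  proof (rule measure_finite_Union)
    show "finite ?I" using finite_vert by simp
    show "?D ` ?I \<subseteq> sets lborel"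
    proof
      fix X assume "X \<in> ?D ` ?I"
      then obtain x where X: "X = ?D x" by blast
      have "is_interval X"
        unfolding is_interval_1
      proof (intro ballI allI impI)
        fix a b \<theta> assume a: "a \<in> X" and b: "b \<in> X" and \<theta>: "a \<le> \<theta> \<and> \<theta> \<le> b"
        then have "le x (vert \<theta>)" "le (vert \<theta>) x" "x \<in> verts" "0 \<le> \<theta>" "\<theta> < 1"
          using le_vert[of a \<theta>] le_vert[of \<theta> b] vert_verts[of a] unfolding X by auto
        then have "vert \<theta> = x" using le_antisym[of x "vert \<theta>"] vert_verts by metis
        then show "\<theta> \<in> X" unfolding X using \<open>0 \<le> \<theta>\<close> \<open>\<theta> < 1\<close> by simp
      qed
      then show "X \<in> sets lborel" using real_interval_borel_measurable by simp
    qed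
    show "disjoint_family_on ?D ?I" unfolding disjoint_family_on_def by blast
    fix x assume "x \<in> ?I"
    have "emeasure lborel (?D x) \<le> emeasure lborel {0..<1::real}" by (rule emeasure_mono) auto
    then show "emeasure lborel (?D x) \<noteq> \<infinity>" by (auto simp: top_unique)
  qed
  moreover have "(\<Union>x\<in>?I. ?D x) = {\<theta> \<in> {0..<1}. R (vert \<theta>)}" by auto
  ultimately show ?thesis by (simp add: weight_def)
qed

text \<open>The heights that select \<open>v\<close> are those between \<open>before v\<close> and
  \<open>cumulative v\<close>, a distance of \<open>\<mu> v\<close>.\<close>

lemma sum_weight_fst:
  assumes v: "v \<in> V"
  shows "sum weight {x \<in> vert ` {0..<1}. fst x = v} = \<mu> v"
proof -
  have "{x \<in> V. key x \<le> key v} = insert v {x \<in> V. key x < key v}"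
    using inj_key v by (force simp: inj_on_def)
  then have u: "cumulative v = before v + \<mu> v" unfolding cumulative_def before_def using finite_V by simp
  have b: "0 \<le> before v" unfolding before_def using \<mu>_nonneg by (intro sum_nonneg) auto
  have u1: "cumulative v \<le> 1" unfolding cumulative_def sum_\<mu>[symmetric] by (rule sum_\<mu>_mono) auto
  have "{\<theta> \<in> {0..<1}. fst (vert \<theta>) = v} = {before v..<cumulative v}"
  proof (intro equalityI subsetI)
    fix \<theta> assume "\<theta> \<in> {\<theta> \<in> {0..<1}. fst (vert \<theta>) = v}"
    then show "\<theta> \<in> {before v..<cumulative v}" using vertex_at[of \<theta>] by (auto simp: vert_def)
  next
    fix \<theta> assume \<theta>: "\<theta> \<in> {before v..<cumulative v}"
    then have \<theta>': "0 \<le> \<theta>" "\<theta> < 1" using b u1 by auto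
    have "key v \<le> key (vertex_at \<theta>)" "key (vertex_at \<theta>) \<le> key v"
      using key_mono[of v \<theta> \<theta> "vertex_at \<theta>"] key_mono[of "vertex_at \<theta>" \<theta> \<theta> v] vertex_at[OF \<theta>'] \<theta> by auto
    then have "vertex_at \<theta> = v" using inj_key vertex_at(1)[OF \<theta>'] v by (auto simp: inj_on_def)
    then show "\<theta> \<in> {\<theta> \<in> {0..<1}. fst (vert \<theta>) = v}" using \<theta>' by (simp add: vert_def)
  qed
  then show ?thesis unfolding sum_weight using u \<mu>_nonneg[OF v] by simp
qed

text \<open>A count is a sum of indicators over layers. Integrated over \<theta>, layer
  \<open>k\<close> contributes the length of its overlap with the interval from 0 to
  \<open>\<Lambda> w\<close>, and these overlaps telescope over the layers.\<close>

lemma sum_weight_count: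
  "(\<Sum>x\<in>vert ` {0..<1}. weight x * real (snd x w)) = \<Lambda> w"
proof -
  let ?A = "vert ` {0..<1}"
  let ?l = "\<Lambda> w"
  have "real (snd x w) = (\<Sum>k<max_count. of_bool (k < snd x w))" if "x \<in> ?A" for x
  proof -
    have x: "x \<in> verts" using that vert_verts by auto
    have "snd x w \<le> max_count" using vertsD(2)[OF x, of w] n_le_max_count[OF vertsD(1)[OF x]] by simp
    then have "{..<max_count} \<inter> {k. k < snd x w} = {..<snd x w}" by auto
    then show ?thesis by (simp add: of_bool_def sum.If_cases)
  qed
  then have "(\<Sum>x\<in>?A. weight x * real (snd x w)) = (\<Sum>x\<in>?A. \<Sum>k<max_count. weight x * of_bool (k < snd x w))"
    by (intro sum.cong) (simp_all only: sum_distrib_left)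
  also have "\<dots> = (\<Sum>k<max_count. \<Sum>x\<in>?A. weight x * of_bool (k < snd x w))" by (rule sum.swap)
  also have "\<dots> = (\<Sum>k<max_count. min ?l (start (Suc k)) - min ?l (start k))"
  proof (rule sum.cong[OF refl])
    fix k
    have "(\<Sum>x\<in>?A. weight x * of_bool (k < snd x w)) = sum weight {x \<in> ?A. k < snd x w}"
      using finite_vert sum_mult_add_of_bool[of ?A weight "\<lambda>_. 0" "\<lambda>x. k < snd x w"] by simp
    also have "\<dots> = measure lborel {\<theta> \<in> {0..<1}. \<theta> < cut k ?l}"
      unfolding sum_weight by (rule arg_cong[where f = "measure lborel"]) (auto simp: vert_def less_count_iff)
    also have "{\<theta> \<in> {0..<1}. \<theta> < cut k ?l} = {0..<max 0 (cut k ?l)}"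
      using layer_le_1[of k] by (auto simp: cut_def)
    also have "measure lborel \<dots> = max 0 (cut k ?l)" by simp
    also have "\<dots> = min ?l (start (Suc k)) - min ?l (start k)"
      unfolding start_Suc cut_def using layer_nonneg[of k] by (auto simp: min_def max_def)
    finally show "(\<Sum>x\<in>?A. weight x * of_bool (k < snd x w)) = min ?l (start (Suc k)) - min ?l (start k)" .
  qed
  also have "\<dots> = min ?l (start max_count) - min ?l (start 0)" by (rule sum_lessThan_telescope)
  also have "\<dots> = ?l" unfolding start_max_count start_0 using \<Lambda>_nonneg[of w] \<Lambda>_le[of w] by simp
  finally show ?thesis .
qed

text \<open>Elements of weight zero are discarded to make the weights positive. The last conjunct
  later yields monotone count functions, and no increment where two cut positions coincide.\<close>

lemma ex_chain:
  "\<exists>A \<alpha>. chain A \<and> (\<forall>x\<in>A. 0 < \<alpha> x) \<and> (\<forall>v\<in>V. sum \<alpha> {x \<in> A. fst x = v} = \<mu> v) \<and>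
     (\<forall>w. (\<Sum>x\<in>A. \<alpha> x * real (snd x w)) = \<Lambda> w) \<and> (\<forall>x\<in>A. \<forall>w w'. \<Lambda> w \<le> \<Lambda> w' \<longrightarrow> snd x w \<le> snd x w')"
proof (intro exI conjI)
  let ?B = "vert ` {0..<1}" and ?A = "{x \<in> vert ` {0..<1}. weight x \<noteq> 0}"
  have nn: "0 \<le> weight x" for x unfolding weight_def by simp
  show "chain ?A" by (rule chain_subset[OF chain_vert]) simp
  show "\<forall>x\<in>?A. 0 < weight x" using nn by (simp add: less_le)
  show "\<forall>v\<in>V. sum weight {x \<in> ?A. fst x = v} = \<mu> v"
  proof
    fix v assume "v \<in> V"
    have "sum weight {x \<in> ?A. fst x = v} = sum weight {x \<in> ?B. fst x = v}"
      using finite_vert by (intro sum.mono_neutral_left) auto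
    then show "sum weight {x \<in> ?A. fst x = v} = \<mu> v"
      by (rule trans[OF _ sum_weight_fst[OF \<open>v \<in> V\<close>]])
  qed
  show "\<forall>w. (\<Sum>x\<in>?A. weight x * real (snd x w)) = \<Lambda> w"
  proof
    fix w
    have "(\<Sum>x\<in>?A. weight x * real (snd x w)) = (\<Sum>x\<in>?B. weight x * real (snd x w))"
      using finite_vert by (intro sum.mono_neutral_left) auto
    then show "(\<Sum>x\<in>?A. weight x * real (snd x w)) = \<Lambda> w" by (rule trans[OF _ sum_weight_count])
  qed
  show "\<forall>x\<in>?A. \<forall>w w'. \<Lambda> w \<le> \<Lambda> w' \<longrightarrow> snd x w \<le> snd x w'"
  proof (intro ballI allI impI)
    fix x w w' assume x: "x \<in> ?A" and le: "\<Lambda> w \<le> \<Lambda> w'"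
    then obtain \<theta> where "0 \<le> \<theta>" "x = vert \<theta>" by auto
    then show "snd x w \<le> snd x w'" using count_mono[OF _ le] by (simp add: vert_def)
  qed
qed

end

section \<open>The triangulation of the semidirect product\<close>

lemma integer_points_Pair: "(x, y) \<in> integer_points \<longleftrightarrow> x \<in> integer_points \<and> y \<in> integer_points"
  unfolding integer_points_def Basis_prod_def by (auto simp: ball_Un)

text \<open>Subtracting the integer \<open>sum c A - 1\<close> from the coefficient of
  \<open>x\<close> reduces to total 1 and keeps the combination a lattice point.\<close>

lemma unimodular_complex_Ints_scaled:
  assumes K: "unimodular_complex K" "A \<in> K" and t: "sum c A \<in> \<int>"
    and z: "(\<Sum>x\<in>A. c x *\<^sub>R x) \<in> integer_points" and x: "x \<in> A"
  shows "c x \<in> \<int>"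
proof -
  have fin: "finite A" using K by (rule unimodular_complex_finite_simplex)
  let ?t = "sum c A"
  let ?d = "\<lambda>y. c y - (if y = x then ?t - 1 else 0)"
  have "sum ?d A = 1" using fin x by (simp add: sum_subtractf)
  moreover have "(\<Sum>y\<in>A. ?d y *\<^sub>R y) = (\<Sum>y\<in>A. c y *\<^sub>R y) - (\<Sum>y\<in>A. if y = x then (?t - 1) *\<^sub>R y else 0)"
    unfolding sum_subtractf[symmetric] by (intro sum.cong) (auto simp: scaleR_diff_left)
  then have "(\<Sum>y\<in>A. ?d y *\<^sub>R y) = (\<Sum>y\<in>A. c y *\<^sub>R y) - (?t - 1) *\<^sub>R x" using fin x by simp
  moreover have "x \<in> integer_points" using unimodular_complex_integer_points[OF K] x by blast
  then have "(\<Sum>y\<in>A. c y *\<^sub>R y) - (?t - 1) *\<^sub>R x \<in> integer_points"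
    using z t by (auto simp: integer_points_def inner_diff_left intro!: Ints_diff Ints_mult)
  ultimately have "?d x \<in> \<int>" using unimodular_complex_Ints[OF K, of ?d x] x by metis
  then have "c x - (?t - 1) \<in> \<int>" by simp
  moreover have "?t - 1 \<in> \<int>" using t by simp
  ultimately have "c x - (?t - 1) + (?t - 1) \<in> \<int>" by (rule Ints_add)
  then show ?thesis by (simp only: diff_add_cancel)
qed

lemma unimodular_complex_weights_scaled:
  assumes K: "unimodular_complex K" "A \<in> K" "B \<in> K"
    and pos: "\<forall>x\<in>A. 0 < \<alpha> x" "\<forall>x\<in>B. 0 < \<beta> x"
    and s: "sum \<alpha> A = sum \<beta> B" and eq: "(\<Sum>x\<in>A. \<alpha> x *\<^sub>R x) = (\<Sum>x\<in>B. \<beta> x *\<^sub>R x)"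
  shows "A = B \<and> (\<forall>x\<in>A. \<alpha> x = \<beta> x)"
proof (cases "A = {} \<or> B = {}")
  case True
  have fin: "finite A" "finite B" using K unimodular_complex_finite_simplex by blast+
  have "A = {}" if "sum \<alpha> A = 0" using sum_pos[OF fin(1), of \<alpha>] pos(1) that by force
  moreover have "B = {}" if "sum \<beta> B = 0" using sum_pos[OF fin(2), of \<beta>] pos(2) that by force
  ultimately show ?thesis using True s by auto
next
  case False
  have fin: "finite A" "finite B" using K unimodular_complex_finite_simplex by blast+
  let ?t = "sum \<alpha> A"
  have t: "0 < ?t" using sum_pos[OF fin(1), of \<alpha>] pos(1) False by auto
  have p: "\<And>x. x \<in> A \<Longrightarrow> 0 < \<alpha> x / ?t" "\<And>x. x \<in> B \<Longrightarrow> 0 < \<beta> x / ?t" using pos t by auto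
  have o: "(\<Sum>x\<in>A. \<alpha> x / ?t) = 1" "(\<Sum>x\<in>B. \<beta> x / ?t) = 1"
    using t s by (simp_all flip: sum_divide_distrib)
  have "(\<Sum>x\<in>A. (\<alpha> x / ?t) *\<^sub>R x) = (1 / ?t) *\<^sub>R (\<Sum>x\<in>A. \<alpha> x *\<^sub>R x)"
    "(\<Sum>x\<in>B. (\<beta> x / ?t) *\<^sub>R x) = (1 / ?t) *\<^sub>R (\<Sum>x\<in>B. \<beta> x *\<^sub>R x)"
    by (simp_all add: scaleR_sum_right)
  then have e: "(\<Sum>x\<in>A. (\<alpha> x / ?t) *\<^sub>R x) = (\<Sum>x\<in>B. (\<beta> x / ?t) *\<^sub>R x)" using eq by simp
  have "\<alpha> x / ?t = \<beta> x / ?t" if "x \<in> A" for x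
    by (rule unimodular_complex_weights(2)[OF K p o e that])
  then show ?thesis using unimodular_complex_weights(1)[OF K p o e] t by auto
qed

text \<open>\<open>e\<close> enumerates the vertices of \<open>KT\<close> and \<open>idx\<close>
  inverts it. Cuts are now indexed by natural numbers: cut \<open>j\<close> comes after the first
  \<open>j\<close> vertices.\<close>

locale staircase_complex = staircase "\<Union>KS" key n
  for KS :: "'a::euclidean_space set set" and key n +
  fixes KT :: "'b::euclidean_space set set" and e :: "nat \<Rightarrow> 'b" and idx :: "'b \<Rightarrow> nat" and m :: nat
  assumes KS: "unimodular_complex KS" and KT: "unimodular_complex KT"
    and e: "e ` {..<m} = \<Union>KT" and idx: "i < m \<Longrightarrow> idx (e i) = i"
begin

definition point :: "'a \<times> (nat \<Rightarrow> nat) \<Rightarrow> 'a \<times> 'b" where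
  "point x = (fst x, \<Sum>i<m. (real (snd x (Suc i)) - real (snd x i)) *\<^sub>R e i)"

text \<open>The count functions that come from multisets of \<open>n (fst x)\<close> vertices of
  \<open>KT\<close>, extended constantly beyond \<open>m\<close> so that they are determined by
  their multiplicities.\<close>

definition good :: "'a \<times> (nat \<Rightarrow> nat) \<Rightarrow> bool" where
  "good x \<longleftrightarrow> snd x 0 = 0 \<and> mono (snd x) \<and> (\<forall>j\<ge>m. snd x j = n (fst x))"

definition support :: "('a \<times> (nat \<Rightarrow> nat)) set \<Rightarrow> nat set" where
  "support A = {i. i < m \<and> (\<exists>x\<in>A. snd x i < snd x (Suc i))}"

definition chains :: "('a \<times> (nat \<Rightarrow> nat)) set set" where
  "chains = {A. chain A \<and> fst ` A \<in> KS \<and> e ` support A \<in> KT \<and> (\<forall>x\<in>A. good x)}"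

definition marginal :: "('a \<times> (nat \<Rightarrow> nat)) set \<Rightarrow> ('a \<times> (nat \<Rightarrow> nat) \<Rightarrow> real) \<Rightarrow> 'a \<Rightarrow> real" where
  "marginal A c v = sum c {x \<in> A. fst x = v}"

text \<open>The coefficient of \<open>e i\<close> in the second component of the combination of
  points with coefficients \<open>c\<close>.\<close>

definition increment :: "('a \<times> (nat \<Rightarrow> nat)) set \<Rightarrow> ('a \<times> (nat \<Rightarrow> nat) \<Rightarrow> real) \<Rightarrow> nat \<Rightarrow> real" where
  "increment A c i = (\<Sum>x\<in>A. c x * (real (snd x (Suc i)) - real (snd x i)))"

section \<open>Combinations of chain points in terms of marginals and increments\<close>

lemma inj_e: "inj_on e {..<m}"
  by (rule inj_on_inverseI[of _ idx]) (simp add: idx)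

lemma chainsD:
  assumes "A \<in> chains"
  shows "chain A" "finite A" "fst ` A \<in> KS" "e ` support A \<in> KT" "x \<in> A \<Longrightarrow> good x"
  using assms chain_finite by (auto simp: chains_def)

lemma sum_fst:
  fixes f :: "'a \<Rightarrow> 'c::real_vector"
  assumes "finite A"
  shows "(\<Sum>x\<in>A. c x *\<^sub>R f (fst x)) = (\<Sum>v\<in>fst ` A. marginal A c v *\<^sub>R f v)"
proof -
  have "(\<Sum>x\<in>A. c x *\<^sub>R f (fst x)) = (\<Sum>v\<in>fst ` A. \<Sum>x\<in>{x \<in> A. fst x = v}. c x *\<^sub>R f (fst x))"
    by (rule sum.image_gen[OF assms])
  also have "\<dots> = (\<Sum>v\<in>fst ` A. marginal A c v *\<^sub>R f v)"
    unfolding marginal_def scaleR_sum_left by (intro sum.cong) auto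
  finally show ?thesis .
qed

lemma sum_fst_real: "finite A \<Longrightarrow> (\<Sum>x\<in>A. c x * f (fst x)) = (\<Sum>v\<in>fst ` A. marginal A c v * f v)"
  using sum_fst[of A c f] by simp

lemma sum_key: "finite A \<Longrightarrow> sum c {x \<in> A. key (fst x) \<le> t} = (\<Sum>v\<in>fst ` A. marginal A c v * of_bool (key v \<le> t))"
  using sum_fst_real[of A c "\<lambda>v. of_bool (key v \<le> t)"] sum_mult_add_of_bool[of A c "\<lambda>_. 0" "\<lambda>x. key (fst x) \<le> t"]
  by simp

lemma sum_marginal: "finite A \<Longrightarrow> sum (marginal A c) (fst ` A) = sum c A"
  using sum_fst_real[of A c "\<lambda>_. 1"] by simp

text \<open>The increments telescope from the count 0 at position 0, so partial sums of coefficients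
  over \<open>KT\<close> are the weighted counts of a chain.\<close>

lemma sum_increment:
  assumes "finite A" "\<forall>x\<in>A. good x"
  shows "(\<Sum>i<j. increment A c i) = (\<Sum>x\<in>A. c x * real (snd x j))"
proof -
  have "(\<Sum>i<j. increment A c i) = (\<Sum>x\<in>A. c x * (\<Sum>i<j. real (snd x (Suc i)) - real (snd x i)))"
    unfolding increment_def sum_distrib_left by (rule sum.swap)
  also have "\<dots> = (\<Sum>x\<in>A. c x * real (snd x j))"
    using assms(2) by (intro sum.cong refl) (simp add: sum_lessThan_telescope[of "\<lambda>i. real (snd _ i)"] good_def)
  finally show ?thesis .
qed

lemma increment_eq_0:
  assumes "\<forall>x\<in>A. good x" "i < m" "i \<notin> support A"
  shows "increment A c i = 0"
  unfolding increment_def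
proof (rule sum.neutral, rule ballI)
  fix x assume x: "x \<in> A"
  then have "snd x i \<le> snd x (Suc i)" "\<not> snd x i < snd x (Suc i)"
    using assms by (auto simp: good_def monoD support_def)
  then show "c x * (real (snd x (Suc i)) - real (snd x i)) = 0" by simp
qed

lemma sum_support:
  fixes f :: "'b \<Rightarrow> 'c::real_vector"
  assumes "\<forall>x\<in>A. good x"
  shows "(\<Sum>w\<in>e ` support A. increment A c (idx w) *\<^sub>R f w) = (\<Sum>i<m. increment A c i *\<^sub>R f (e i))"
proof -
  have sub: "support A \<subseteq> {..<m}" by (auto simp: support_def)
  have "(\<Sum>w\<in>e ` support A. increment A c (idx w) *\<^sub>R f w) = (\<Sum>i\<in>support A. increment A c i *\<^sub>R f (e i))"
    using sum.reindex[OF inj_on_subset[OF inj_e sub], of "\<lambda>w. increment A c (idx w) *\<^sub>R f w"] idx sub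
    by (auto intro!: sum.cong)
  also have "\<dots> = (\<Sum>i<m. increment A c i *\<^sub>R f (e i))"
    using sub increment_eq_0[OF assms] by (intro sum.mono_neutral_left) auto
  finally show ?thesis .
qed

text \<open>The increments up to \<open>m\<close> telescope to the full counts
  \<open>n (fst x)\<close>. Hence the first component fixes the total weight of the second.\<close>

lemma sum_support_total:
  assumes "finite A" "\<forall>x\<in>A. good x"
  shows "(\<Sum>w\<in>e ` support A. increment A c (idx w)) = (\<Sum>v\<in>fst ` A. marginal A c v * real (n v))"
proof -
  have "(\<Sum>w\<in>e ` support A. increment A c (idx w)) = (\<Sum>i<m. increment A c i)"
    using sum_support[OF assms(2), of c "\<lambda>_. 1::real"] by simp
  also have "\<dots> = (\<Sum>x\<in>A. c x * real (n (fst x)))"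
    unfolding sum_increment[OF assms] using assms(2) by (intro sum.cong) (auto simp: good_def)
  also have "\<dots> = (\<Sum>v\<in>fst ` A. marginal A c v * real (n v))" by (rule sum_fst_real[OF assms(1)])
  finally show ?thesis .
qed

text \<open>The coefficients enter only through marginals and increments, which are coordinates in
  the two given complexes.\<close>

lemma sum_point:
  assumes "finite A" "\<forall>x\<in>A. good x"
  shows "(\<Sum>x\<in>A. c x *\<^sub>R point x) =
    (\<Sum>v\<in>fst ` A. marginal A c v *\<^sub>R v, \<Sum>w\<in>e ` support A. increment A c (idx w) *\<^sub>R w)"
proof (rule prod_eqI)
  show "fst (\<Sum>x\<in>A. c x *\<^sub>R point x) = fst (\<Sum>v\<in>fst ` A. marginal A c v *\<^sub>R v, \<Sum>w\<in>e ` support A. increment A c (idx w) *\<^sub>R w)"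
    using sum_fst[OF assms(1), of c "\<lambda>v. v"] by (simp add: fst_sum point_def)
  have "snd (\<Sum>x\<in>A. c x *\<^sub>R point x) = (\<Sum>x\<in>A. \<Sum>i<m. (c x * (real (snd x (Suc i)) - real (snd x i))) *\<^sub>R e i)"
    by (simp add: snd_sum point_def scaleR_sum_right)
  also have "\<dots> = (\<Sum>i<m. increment A c i *\<^sub>R e i)"
    unfolding increment_def scaleR_sum_left by (rule sum.swap)
  also have "\<dots> = (\<Sum>w\<in>e ` support A. increment A c (idx w) *\<^sub>R w)"
    using sum_support[OF assms(2), of c "\<lambda>w. w"] by simp
  finally show "snd (\<Sum>x\<in>A. c x *\<^sub>R point x) = snd (\<Sum>v\<in>fst ` A. marginal A c v *\<^sub>R v, \<Sum>w\<in>e ` support A. increment A c (idx w) *\<^sub>R w)"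
    by simp
qed

lemma increment_mem: "A \<in> chains \<Longrightarrow> i < m \<Longrightarrow> (\<And>w. w \<in> e ` support A \<Longrightarrow> increment A c (idx w) \<in> \<int>) \<Longrightarrow> increment A c i \<in> \<int>"
  using increment_eq_0[of A i c] chainsD(5) idx by (metis Ints_0 imageI)

section \<open>The chains form a unimodular complex\<close>

lemma snd_good_min: "good x \<Longrightarrow> snd x j = snd x (min j m)"
  by (cases "j \<le> m") (auto simp: good_def min_def)

text \<open>Integrality passes from \<open>KS\<close> to the marginals, then to the total of the
  increments because \<open>n\<close> is integral, and so by \<open>KT\<close> to each increment.
  All sums demanded by \<open>chain_Ints\<close> are integral combinations of these.\<close>

lemma chains_Ints:
  assumes A: "A \<in> chains" and c: "sum c A = 1" and z: "(\<Sum>x\<in>A. c x *\<^sub>R point x) \<in> integer_points"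
    and p: "p \<in> A"
  shows "c p \<in> \<int>"
proof -
  have fin: "finite A" and g: "\<forall>x\<in>A. good x" using chainsD[OF A] by blast+
  note zz = z[unfolded sum_point[OF fin g] integer_points_Pair]
  have \<mu>: "marginal A c v \<in> \<int>" if "v \<in> fst ` A" for v
    using unimodular_complex_Ints[OF KS chainsD(3)[OF A], of "marginal A c"] sum_marginal[OF fin] c zz that by metis
  have f: "(\<Sum>v\<in>fst ` A. marginal A c v * f v) \<in> \<int>" if "\<And>v. f v \<in> \<int>" for f
    using \<mu> that by (intro Ints_sum Ints_mult) auto
  have "(\<Sum>w\<in>e ` support A. increment A c (idx w)) \<in> \<int>"
    unfolding sum_support_total[OF fin g] by (rule f) simp
  then have "increment A c (idx w) \<in> \<int>" if "w \<in> e ` support A" for w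
    using unimodular_complex_Ints_scaled[OF KT chainsD(4)[OF A], of "\<lambda>w. increment A c (idx w)"] zz that by blast
  then have \<nu>: "increment A c i \<in> \<int>" if "i < m" for i using increment_mem[OF A that] by blast
  show ?thesis
  proof (rule chain_Ints[OF chainsD(1)[OF A] p])
    show "sum c {x \<in> A. key (fst x) \<le> t} \<in> \<int>" for t unfolding sum_key[OF fin] by (rule f) simp
    show "(\<Sum>x\<in>A. c x * real (min k (n (fst x)))) \<in> \<int>" for k
      unfolding sum_fst_real[OF fin, of c "\<lambda>v. real (min k (n v))"] by (rule f) simp
    fix j
    have "(\<Sum>x\<in>A. c x * real (snd x j)) = (\<Sum>x\<in>A. c x * real (snd x (min j m)))"
      using g snd_good_min[of _ j] by (intro sum.cong) auto
    also have "\<dots> \<in> \<int>"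
      unfolding sum_increment[OF fin g, symmetric] by (intro Ints_sum \<nu>) auto
    finally show "(\<Sum>x\<in>A. c x * real (snd x j)) \<in> \<int>" .
  qed
qed

text \<open>The represented point fixes the marginals; their totals against \<open>n\<close> agree,
  so it fixes the increments too, and with them every sum that \<open>chain_unique_subset\<close>
  compares.\<close>

lemma chains_unique:
  assumes A: "A \<in> chains" and B: "B \<in> chains"
    and pos: "\<forall>x\<in>A. 0 < \<alpha> x" "\<forall>x\<in>B. 0 < \<beta> x" and s: "sum \<alpha> A = 1" "sum \<beta> B = 1"
    and eq: "(\<Sum>x\<in>A. \<alpha> x *\<^sub>R point x) = (\<Sum>x\<in>B. \<beta> x *\<^sub>R point x)"
  shows "A = B"
proof -
  have fin: "finite A" "finite B" and g: "\<forall>x\<in>A. good x" "\<forall>x\<in>B. good x"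
    using chainsD[OF A] chainsD[OF B] by blast+
  have mpos: "0 < marginal C c v" if "finite C" "\<forall>x\<in>C. 0 < c x" "v \<in> fst ` C" for C c v
    unfolding marginal_def using that by (intro sum_pos) auto
  have ipos: "0 < increment C c (idx w)" if C: "finite C" "\<forall>x\<in>C. good x" "\<forall>x\<in>C. 0 < c x" "w \<in> e ` support C" for C c w
  proof -
    from C(4) obtain i x where i: "w = e i" "i < m" "x \<in> C" "snd x i < snd x (Suc i)" by (auto simp: support_def)
    have "0 \<le> c y * (real (snd y (Suc i)) - real (snd y i))" if "y \<in> C" for y
      using C(2,3) that by (auto intro!: mult_nonneg_nonneg simp: good_def monoD less_imp_le)
    moreover have "0 < c x * (real (snd x (Suc i)) - real (snd x i))" using C(3) i by simp
    ultimately have "0 < increment C c i" unfolding increment_def using C(1) i(3) by (intro sum_pos2)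
    then show ?thesis using i idx by simp
  qed
  note eq' = eq[unfolded sum_point[OF fin(1) g(1)] sum_point[OF fin(2) g(2)] prod.inject]
  have "fst ` A = fst ` B \<and> (\<forall>v\<in>fst ` A. marginal A \<alpha> v = marginal B \<beta> v)"
    by (rule unimodular_complex_weights_scaled[OF KS chainsD(3)[OF A] chainsD(3)[OF B]])
      (use mpos fin pos s eq' sum_marginal in auto)
  then have F: "fst ` A = fst ` B" and \<mu>: "\<And>v. v \<in> fst ` A \<Longrightarrow> marginal A \<alpha> v = marginal B \<beta> v" by blast+
  have f: "(\<Sum>v\<in>fst ` A. marginal A \<alpha> v * f v) = (\<Sum>v\<in>fst ` B. marginal B \<beta> v * f v)" for f
    using \<mu> by (intro sum.cong F) (simp add: F)
  have "e ` support A = e ` support B \<and> (\<forall>w\<in>e ` support A. increment A \<alpha> (idx w) = increment B \<beta> (idx w))"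
  proof (rule unimodular_complex_weights_scaled[OF KT chainsD(4)[OF A] chainsD(4)[OF B]])
    show "(\<Sum>w\<in>e ` support A. increment A \<alpha> (idx w)) = (\<Sum>w\<in>e ` support B. increment B \<beta> (idx w))"
      unfolding sum_support_total[OF fin(1) g(1)] sum_support_total[OF fin(2) g(2)] by (rule f)
    show "(\<Sum>w\<in>e ` support A. increment A \<alpha> (idx w) *\<^sub>R w) = (\<Sum>w\<in>e ` support B. increment B \<beta> (idx w) *\<^sub>R w)"
      using eq' by blast
    show "\<forall>w\<in>e ` support A. 0 < increment A \<alpha> (idx w)" using ipos fin g pos by blast
    show "\<forall>w\<in>e ` support B. 0 < increment B \<beta> (idx w)" using ipos fin g pos by blast
  qed
  then have G: "e ` support A = e ` support B"
    and \<nu>: "\<And>w. w \<in> e ` support A \<Longrightarrow> increment A \<alpha> (idx w) = increment B \<beta> (idx w)" by blast+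
  have sub: "support A \<subseteq> {..<m}" "support B \<subseteq> {..<m}" by (auto simp: support_def)
  have S: "support A = support B" using inj_on_image_eq_iff[OF inj_e sub] G by blast
  have \<nu>': "increment A \<alpha> i = increment B \<beta> i" if "i < m" for i
    using \<nu>[of "e i"] idx[OF that] increment_eq_0[OF g(1) that] increment_eq_0[OF g(2) that] S
    by (cases "i \<in> support A") auto
  have keys: "sum \<alpha> {x \<in> A. key (fst x) \<le> t} = sum \<beta> {x \<in> B. key (fst x) \<le> t}" for t
    unfolding sum_key[OF fin(1)] sum_key[OF fin(2)] by (rule f)
  have mins: "(\<Sum>x\<in>A. \<alpha> x * real (min k (n (fst x)))) = (\<Sum>x\<in>B. \<beta> x * real (min k (n (fst x))))" for k
    unfolding sum_fst_real[OF fin(1), of \<alpha> "\<lambda>v. real (min k (n v))"] sum_fst_real[OF fin(2), of \<beta> "\<lambda>v. real (min k (n v))"]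
    by (rule f)
  have cnts: "(\<Sum>x\<in>A. \<alpha> x * real (snd x j)) = (\<Sum>x\<in>B. \<beta> x * real (snd x j))" for j
  proof -
    have "(\<Sum>x\<in>A. \<alpha> x * real (snd x j)) = (\<Sum>x\<in>A. \<alpha> x * real (snd x (min j m)))"
      using g snd_good_min[of _ j] by (intro sum.cong) auto
    also have "\<dots> = (\<Sum>x\<in>B. \<beta> x * real (snd x (min j m)))"
      unfolding sum_increment[OF fin(1) g(1), symmetric] sum_increment[OF fin(2) g(2), symmetric]
      by (intro sum.cong \<nu>') auto
    also have "\<dots> = (\<Sum>x\<in>B. \<beta> x * real (snd x j))"
      using g snd_good_min[of _ j] by (intro sum.cong) auto
    finally show ?thesis .
  qed
  show ?thesis
  proof (rule subset_antisym)
    show "A \<subseteq> B"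
      by (rule chain_unique_subset[OF chainsD(1)[OF A] chainsD(1)[OF B] pos]) (simp_all only: s keys mins cnts)
    show "B \<subseteq> A"
      by (rule chain_unique_subset[OF chainsD(1)[OF B] chainsD(1)[OF A] pos(2,1)]) (simp_all only: s keys mins cnts)
  qed
qed

lemma chains_subset: "A \<in> chains \<Longrightarrow> B \<subseteq> A \<Longrightarrow> B \<in> chains"
proof -
  assume A: "A \<in> chains" and B: "B \<subseteq> A"
  have "support B \<subseteq> support A" using B unfolding support_def by blast
  then have "e ` support B \<in> KT" "fst ` B \<in> KS"
    by (auto intro: unimodular_complex_subset[OF KT chainsD(4)[OF A] image_mono]
        unimodular_complex_subset[OF KS chainsD(3)[OF A] image_mono[OF B]])
  then show ?thesis using A B chain_subset unfolding chains_def by blast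
qed

text \<open>Singletons are chains, so two elements with the same point are equal by
  uniqueness.\<close>

lemma inj_on_point: "A \<in> chains \<Longrightarrow> inj_on point A"
proof (rule inj_onI)
  fix x y assume A: "A \<in> chains" and xy: "x \<in> A" "y \<in> A" "point x = point y"
  then have "{x} \<in> chains" "{y} \<in> chains" using chains_subset by blast+
  then have "{x} = {y}" by (rule chains_unique[where \<alpha> = "\<lambda>_. 1" and \<beta> = "\<lambda>_. 1"]) (use xy(3) in auto)
  then show "x = y" by simp
qed

text \<open>A good element is determined by its vertex and its counts at the positions up to
  \<open>m\<close>, each at most \<open>?N\<close>.\<close>

lemma finite_chains: "finite chains"
proof -
  let ?N = "sum n (\<Union>KS)"
  let ?V = "\<Union>KS \<times> (\<lambda>f j. f (min j m)) ` ({..m} \<rightarrow>\<^sub>E {..?N})"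
  have "x \<in> ?V" if A: "A \<in> chains" and x: "x \<in> A" for A x
  proof -
    have v: "x \<in> verts" and g: "good x" using chain_verts[OF chainsD(1)[OF A] x] chainsD(5)[OF A x] by blast+
    have "snd x j \<le> ?N" for j
      using vertsD(2)[OF v, of j] member_le_sum[OF vertsD(1)[OF v] _ finite_V, of n] by simp
    then have "restrict (snd x) {..m} \<in> {..m} \<rightarrow>\<^sub>E {..?N}" by auto
    moreover have "snd x = (\<lambda>j. restrict (snd x) {..m} (min j m))" using snd_good_min[OF g] by (auto intro!: ext)
    ultimately have "snd x \<in> (\<lambda>f j. f (min j m)) ` ({..m} \<rightarrow>\<^sub>E {..?N})" by blast
    then show ?thesis using vertsD(1)[OF v] by (simp add: mem_Times_iff)
  qed
  then have "chains \<subseteq> Pow ?V" by blast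
  moreover have "finite ?V"
    by (intro finite_cartesian_product finite_V finite_imageI[OF finite_PiE]) auto
  ultimately show ?thesis by (meson finite_Pow_iff finite_subset)
qed

lemma point_integer_points:
  assumes "A \<in> chains" "x \<in> A"
  shows "point x \<in> integer_points"
proof -
  have "fst x \<in> integer_points"
    using unimodular_complex_integer_points[OF KS chainsD(3)[OF assms(1)]] assms(2) by blast
  moreover have "e i \<in> integer_points" if i: "i < m" for i
  proof -
    have "e i \<in> \<Union>KT" using e i by blast
    then show ?thesis using unimodular_complex_integer_points[OF KT] by blast
  qed
  ultimately show ?thesis
    unfolding point_def integer_points_Pair by (auto intro!: integer_points_sum)
qed

lemma unimodular_complex_chains: "unimodular_complex ((`) point ` chains)"
  unfolding unimodular_complex_def
proof (intro conjI ballI allI impI)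
  show "finite ((`) point ` chains)" using finite_chains by simp
next
  fix A' assume "A' \<in> (`) point ` chains"
  then obtain A where A: "A' = point ` A" "A \<in> chains" by blast
  show "finite A'" using A chainsD(2) by simp
  show "A' \<subseteq> integer_points" using A point_integer_points by blast
  show "B' \<in> (`) point ` chains" if "B' \<subseteq> A'" for B'
  proof -
    obtain B where "B \<subseteq> A" "B' = point ` B" using \<open>B' \<subseteq> A'\<close> unfolding A(1) by (auto elim: subset_imageE)
    then show ?thesis using chains_subset[OF A(2)] by blast
  qed
  show "c x \<in> \<int>" if "sum c A' = 1" "(\<Sum>x\<in>A'. c x *\<^sub>R x) \<in> integer_points" "x \<in> A'" for c x
    using that chains_Ints[OF A(2), of "c \<circ> point"] unfolding A(1) sum.reindex[OF inj_on_point[OF A(2)]]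
    by (auto simp: o_def)
  fix B' \<alpha> \<beta> assume "B' \<in> (`) point ` chains"
  then obtain B where B: "B' = point ` B" "B \<in> chains" by blast
  assume pos: "\<forall>x\<in>A'. 0 < \<alpha> x" "\<forall>x\<in>B'. 0 < \<beta> x" and s: "sum \<alpha> A' = 1" "sum \<beta> B' = 1"
    and eq: "(\<Sum>x\<in>A'. \<alpha> x *\<^sub>R x) = (\<Sum>x\<in>B'. \<beta> x *\<^sub>R x)"
  note reindex = sum.reindex[OF inj_on_point[OF A(2)]] sum.reindex[OF inj_on_point[OF B(2)]]
  have "A = B"
    by (rule chains_unique[OF A(2) B(2), where \<alpha> = "\<alpha> \<circ> point" and \<beta> = "\<beta> \<circ> point"])
      (use pos s eq in \<open>unfold A(1) B(1) reindex, auto simp: o_def\<close>)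
  then show "A' = B'" using A B by simp
qed

text \<open>Partial sums of \<nu> in the enumeration of \<open>KT\<close> serve as cut positions;
  the resulting chain has marginals \<mu> and increments \<nu>.\<close>

lemma ex_chains:
  assumes F: "F \<in> KS" "\<forall>v\<in>F. 0 < \<mu> v" "sum \<mu> F = 1"
    and G: "G \<in> KT" "\<forall>w\<in>G. 0 < \<nu> w" "sum \<nu> G = (\<Sum>v\<in>F. \<mu> v * real (n v))"
  shows "\<exists>A\<in>chains. (\<Sum>v\<in>F. \<mu> v *\<^sub>R v, \<Sum>w\<in>G. \<nu> w *\<^sub>R w) \<in> convex hull (point ` A)"
proof -
  define \<mu>' where "\<mu>' v = (if v \<in> F then \<mu> v else 0)" for v
  define \<nu>' where "\<nu>' i = (if e i \<in> G then \<nu> (e i) else 0)" for i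
  \<comment> \<open>Capping at \<open>m\<close> keeps the positions constant from \<open>m\<close>
    on, at the full length of the interval, and makes their range finite.\<close>
  define \<Lambda> where "\<Lambda> j = (\<Sum>i<min j m. \<nu>' i)" for j
  have FV: "F \<subseteq> \<Union>KS" using F by blast
  have \<mu>': "(\<Sum>v\<in>\<Union>KS. \<mu>' v *\<^sub>R f v) = (\<Sum>v\<in>F. \<mu> v *\<^sub>R f v)" for f :: "'a \<Rightarrow> 'c::real_vector"
    unfolding \<mu>'_def by (rule sum.mono_neutral_cong_right) (use finite_V FV in auto)
  have GW: "G \<subseteq> e ` {..<m}" using G(1) e by blast
  have \<nu>': "(\<Sum>i<m. \<nu>' i *\<^sub>R f (e i)) = (\<Sum>w\<in>G. \<nu> w *\<^sub>R f w)" for f :: "'b \<Rightarrow> 'c::real_vector"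
  proof -
    have "(\<Sum>i<m. \<nu>' i *\<^sub>R f (e i)) = (\<Sum>w\<in>e ` {..<m}. (if w \<in> G then \<nu> w else 0) *\<^sub>R f w)"
      unfolding sum.reindex[OF inj_e] by (simp add: \<nu>'_def)
    also have "\<dots> = (\<Sum>w\<in>G. \<nu> w *\<^sub>R f w)"
      by (rule sum.mono_neutral_cong_right) (use GW in auto)
    finally show ?thesis .
  qed
  have \<nu>'_nn: "0 \<le> \<nu>' i" for i using G(2) by (auto simp: \<nu>'_def less_imp_le)
  have \<Lambda>_mono: "\<Lambda> i \<le> \<Lambda> j" if "i \<le> j" for i j
    unfolding \<Lambda>_def using that \<nu>'_nn by (intro sum_mono2) auto
  have \<Lambda>_m: "\<Lambda> j = (\<Sum>v\<in>\<Union>KS. \<mu>' v * real (n v))" if "m \<le> j" for j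
    using that \<nu>'[of "\<lambda>_. 1::real"] \<mu>'[of "\<lambda>v. real (n v)"] G(3) by (simp add: \<Lambda>_def min_absorb2)
  interpret w: staircase_weights "\<Union>KS" key n \<mu>' \<Lambda>
  proof
    show "0 \<le> \<mu>' v" for v using F(2) by (auto simp: \<mu>'_def less_imp_le)
    show "sum \<mu>' (\<Union>KS) = 1" using \<mu>'[of "\<lambda>_. 1::real"] F(3) by simp
    show "0 \<le> \<Lambda> j" for j unfolding \<Lambda>_def using \<nu>'_nn by (intro sum_nonneg) auto
    show "\<Lambda> j \<le> (\<Sum>v\<in>\<Union>KS. \<mu>' v * real (n v))" for j
      using \<Lambda>_m[of "max j m"] \<Lambda>_mono[of j "max j m"] by simp
    have "range \<Lambda> \<subseteq> \<Lambda> ` {..m}"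
    proof
      fix l assume "l \<in> range \<Lambda>"
      then obtain j where "l = \<Lambda> j" by blast
      then have "l = \<Lambda> (min j m)" by (simp add: \<Lambda>_def)
      then show "l \<in> \<Lambda> ` {..m}" by simp
    qed
    then show "finite (range \<Lambda>)" by (rule finite_subset) simp
  qed
  obtain A \<alpha> where A: "chain A" and pos: "\<forall>x\<in>A. 0 < \<alpha> x"
    and marg: "\<forall>v\<in>\<Union>KS. sum \<alpha> {x \<in> A. fst x = v} = \<mu>' v"
    and cnt: "\<forall>j. (\<Sum>x\<in>A. \<alpha> x * real (snd x j)) = \<Lambda> j"
    and mon: "\<forall>x\<in>A. \<forall>i j. \<Lambda> i \<le> \<Lambda> j \<longrightarrow> snd x i \<le> snd x j"
    using w.ex_chain by blast
  have fin: "finite A" using A by (rule chain_finite)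
  have fstV: "fst x \<in> \<Union>KS" if "x \<in> A" for x using vertsD(1)[OF chain_verts[OF A that]] .
  have fst: "fst x \<in> F" if x: "x \<in> A" for x
  proof -
    have "{y \<in> A. fst y = fst x} \<noteq> {}" using x by blast
    then have "0 < sum \<alpha> {y \<in> A. fst y = fst x}" using pos fin by (intro sum_pos) auto
    then have "0 < \<mu>' (fst x)" using bspec[OF marg fstV[OF x]] by simp
    then show ?thesis by (simp add: \<mu>'_def split: if_splits)
  qed
  have mg: "marginal A \<alpha> v = \<mu>' v" if "v \<in> \<Union>KS" for v
    using bspec[OF marg that] by (simp add: marginal_def)
  have sub: "fst ` A \<subseteq> \<Union>KS" using fstV by blast
  have sumV: "(\<Sum>v\<in>fst ` A. marginal A \<alpha> v *\<^sub>R f v) = (\<Sum>v\<in>F. \<mu> v *\<^sub>R f v)" for f :: "'a \<Rightarrow> 'c::real_vector"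
  proof -
    have "(\<Sum>v\<in>fst ` A. marginal A \<alpha> v *\<^sub>R f v) = (\<Sum>v\<in>\<Union>KS. \<mu>' v *\<^sub>R f v)"
    proof (rule sum.mono_neutral_cong_left[OF finite_V sub])
      show "\<forall>v\<in>\<Union>KS - fst ` A. \<mu>' v *\<^sub>R f v = 0"
      proof
        fix v assume v: "v \<in> \<Union>KS - fst ` A"
        then have "{x \<in> A. fst x = v} = {}" by (auto simp: image_iff)
        then have "\<mu>' v = 0" using mg[of v] v unfolding marginal_def by (metis DiffD1 sum.empty)
        then show "\<mu>' v *\<^sub>R f v = 0" by simp
      qed
    next
      fix v assume "v \<in> fst ` A"
      then have "v \<in> \<Union>KS" using sub by (rule subsetD[rotated])
      then show "marginal A \<alpha> v *\<^sub>R f v = \<mu>' v *\<^sub>R f v" by (simp only: mg)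
    qed
    then show ?thesis unfolding \<mu>' .
  qed
  have good: "good x" if x: "x \<in> A" for x
    unfolding good_def
  proof (intro conjI allI impI)
    \<comment> \<open>The cut at 0 is empty; with positive weights every count there
      vanishes.\<close>
    have "(\<Sum>x\<in>A. \<alpha> x * real (snd x 0)) = 0" using cnt by (simp add: \<Lambda>_def)
    then have "\<alpha> x * real (snd x 0) = 0"
      using sum_nonneg_eq_0_iff[OF fin, of "\<lambda>x. \<alpha> x * real (snd x 0)"] pos x by (simp add: less_imp_le)
    then show "snd x 0 = 0" using pos x by fastforce
    show "mono (snd x)" using mon x \<Lambda>_mono by (simp add: mono_def)
    fix j assume j: "m \<le> j"
    \<comment> \<open>No count exceeds \<open>n (fst x)\<close>, and the weighted totals agree from
      \<open>m\<close> on, so each count is full there.\<close>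
    have "(\<Sum>x\<in>A. \<alpha> x * real (n (fst x))) = (\<Sum>x\<in>A. \<alpha> x * real (snd x j))"
      unfolding sum_fst_real[OF fin, of \<alpha> "\<lambda>v. real (n v)"]
      using sumV[of "\<lambda>v. real (n v)"] cnt \<Lambda>_m[OF j] \<mu>'[of "\<lambda>v. real (n v)"] by simp
    then have "(\<Sum>x\<in>A. \<alpha> x * (real (n (fst x)) - real (snd x j))) = 0"
      by (simp add: right_diff_distrib sum_subtractf)
    moreover have "0 \<le> \<alpha> y * (real (n (fst y)) - real (snd y j))" if "y \<in> A" for y
      using vertsD(2)[OF chain_verts[OF A that], of j] pos that by (simp add: less_imp_le)
    ultimately have "\<alpha> x * (real (n (fst x)) - real (snd x j)) = 0"
      using sum_nonneg_eq_0_iff[OF fin, of "\<lambda>x. \<alpha> x * (real (n (fst x)) - real (snd x j))"] x by simp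
    then show "snd x j = n (fst x)" using pos x by fastforce
  qed
  have supp: "e ` support A \<subseteq> G"
  proof
    fix w assume "w \<in> e ` support A"
    then obtain i x where i: "w = e i" "i < m" "x \<in> A" "snd x i < snd x (Suc i)" by (auto simp: support_def)
    show "w \<in> G"
    proof (rule ccontr)
      assume "w \<notin> G"
      \<comment> \<open>A vertex outside \<open>G\<close> has a piece of length zero, so the cuts on
        its two sides coincide and give equal counts.\<close>
      then have "\<Lambda> (Suc i) = \<Lambda> i" using i by (simp add: \<Lambda>_def \<nu>'_def min_absorb1)
      then have "snd x (Suc i) \<le> snd x i" using mon i(3) by simp
      then show False using i by simp
    qed
  qed
  have "fst ` A \<in> KS" using unimodular_complex_subset[OF KS F(1)] fst by blast
  moreover have "e ` support A \<in> KT" using unimodular_complex_subset[OF KT G(1) supp] .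
  ultimately have mem: "A \<in> chains" using A good unfolding chains_def by blast
  have g: "\<forall>x\<in>A. good x" using good by blast
  have inc: "increment A \<alpha> i = \<nu>' i" if "i < m" for i
  proof -
    have "(\<Sum>i<Suc i. increment A \<alpha> i) = (\<Sum>i<Suc i. \<nu>' i)" "(\<Sum>i<i. increment A \<alpha> i) = (\<Sum>i<i. \<nu>' i)"
      unfolding sum_increment[OF fin g] using cnt that by (simp_all only: \<Lambda>_def min_absorb1 Suc_leI less_imp_le)
    then show ?thesis by simp
  qed
  have "(\<Sum>w\<in>e ` support A. increment A \<alpha> (idx w) *\<^sub>R w) = (\<Sum>w\<in>G. \<nu> w *\<^sub>R w)"
    unfolding sum_support[OF g, of \<alpha> "\<lambda>w. w"] \<nu>'[of "\<lambda>w. w", symmetric] using inc by simp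
  then have "(\<Sum>x\<in>A. \<alpha> x *\<^sub>R point x) = (\<Sum>v\<in>F. \<mu> v *\<^sub>R v, \<Sum>w\<in>G. \<nu> w *\<^sub>R w)"
    unfolding sum_point[OF fin g] sumV by simp
  moreover have "sum \<alpha> A = 1"
    using sum_marginal[OF fin, of \<alpha>] sumV[of "\<lambda>_. 1::real"] F(3) by simp
  then have "(\<Sum>x\<in>A. \<alpha> x *\<^sub>R point x) \<in> convex hull (point ` A)"
    using pos by (intro convex_sum[OF fin convex_convex_hull]) (auto simp: less_imp_le hull_inc)
  ultimately show ?thesis using mem by auto
qed

text \<open>A single element is itself a chain with coefficient 1. The representation shows that
  vertices of the triangulation lie in the semidirect product.\<close>

lemma point_weights:
  assumes "A \<in> chains" "x \<in> A"
  shows "\<exists>G\<in>KT. \<exists>\<nu>. (\<forall>w\<in>G. 0 \<le> \<nu> w) \<and> sum \<nu> G = real (n (fst x)) \<and>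
    point x = (fst x, \<Sum>w\<in>G. \<nu> w *\<^sub>R w)"
proof -
  have x: "{x} \<in> chains" using assms chains_subset by blast
  have g: "\<forall>y\<in>{x}. good y" using chainsD(5)[OF x] by blast
  have marg: "marginal {x} (\<lambda>_. 1) (fst x) = 1"
  proof -
    have "{y \<in> {x}. fst y = fst x} = {x}" by blast
    then show ?thesis by (simp add: marginal_def)
  qed
  have "0 \<le> increment {x} (\<lambda>_. 1) i" for i
    using g by (simp add: increment_def good_def monoD)
  moreover have "(\<Sum>w\<in>e ` support {x}. increment {x} (\<lambda>_. 1) (idx w)) = real (n (fst x))"
    using sum_support_total[OF _ g, of "\<lambda>_. 1"] marg by simp
  moreover have "point x = (fst x, \<Sum>w\<in>e ` support {x}. increment {x} (\<lambda>_. 1) (idx w) *\<^sub>R w)"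
    using sum_point[OF _ g, of "\<lambda>_. 1"] marg by simp
  ultimately show ?thesis by (intro bexI[OF _ chainsD(4)[OF x]] exI conjI ballI)
qed

end

text \<open>All indices \<open>r v\<close> are below \<open>N\<close>, so the multiple of
  \<open>n v\<close> dominates the key and \<open>r\<close> only breaks ties.\<close>

lemma ex_antitone_key:
  fixes n :: "'v \<Rightarrow> nat"
  assumes "finite V"
  shows "\<exists>key :: 'v \<Rightarrow> real. inj_on key V \<and> (\<forall>v\<in>V. \<forall>v'\<in>V. key v \<le> key v' \<longrightarrow> n v' \<le> n v)"
proof -
  obtain N :: nat and r where r: "r ` V = {i. i < N}" "inj_on r V"
    using finite_imp_inj_to_nat_seg[OF assms] by blast
  define key where "key v = real (r v) - real N * real (n v)" for v
  have anti: "n v' \<le> n v" if "v \<in> V" "v' \<in> V" "key v \<le> key v'" for v v'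
  proof (rule ccontr)
    assume "\<not> ?thesis"
    then have "real N * (real (n v) + 1) \<le> real N * real (n v')" by (intro mult_left_mono) auto
    moreover have "r v' < N" using r(1) that(2) by blast
    ultimately show False using that(3) by (simp add: key_def algebra_simps)
  qed
  have "inj_on key V"
  proof (rule inj_onI)
    fix v v' assume v: "v \<in> V" "v' \<in> V" "key v = key v'"
    then have "n v = n v'" using anti[of v v'] anti[of v' v] by simp
    then have "r v = r v'" using v(3) by (simp add: key_def)
    then show "v = v'" using r(2) v by (simp add: inj_on_def)
  qed
  with anti show ?thesis by blast
qed

text \<open>The union whose hull is taken is already convex, because \<phi> is affine and
  nonnegative on the convex set \<open>Q\<close>.\<close>

lemma semidirect_productE:
  assumes "convex Q" "convex P" and \<phi>: "affine_map \<phi>" "\<forall>a\<in>Q. 0 \<le> \<phi> a"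
    and z: "z \<in> semidirect_product Q \<phi> P"
  obtains a p where "a \<in> Q" "p \<in> P" "z = (a, \<phi> a *\<^sub>R p)"
proof -
  let ?U = "\<Union>a\<in>Q. {a} \<times> ((\<lambda>x. \<phi> a *\<^sub>R x) ` P)"
  obtain g c where g: "linear g" and \<phi>g: "\<And>x. \<phi> x = g x + c" using \<phi>(1) unfolding affine_map_def by blast
  have "convex ?U"
  proof (rule convexI)
    fix x y and u v :: real
    assume "x \<in> ?U" "y \<in> ?U" and uv: "0 \<le> u" "0 \<le> v" "u + v = 1"
    then obtain a p b q where x: "x = (a, \<phi> a *\<^sub>R p)" "a \<in> Q" "p \<in> P"
      and y: "y = (b, \<phi> b *\<^sub>R q)" "b \<in> Q" "q \<in> P" by blast
    let ?d = "u *\<^sub>R a + v *\<^sub>R b"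
    have dQ: "?d \<in> Q" using convexD[OF assms(1) x(2) y(2) uv] .
    have "c = u * c + v * c" using uv(3) by (metis distrib_right mult_1)
    then have t: "\<phi> ?d = u * \<phi> a + v * \<phi> b"
      by (simp add: \<phi>g linear_add[OF g] linear_cmul[OF g] distrib_left)
    have nn: "0 \<le> u * \<phi> a" "0 \<le> v * \<phi> b" using uv \<phi>(2) x y by auto
    have "\<exists>r\<in>P. u *\<^sub>R x + v *\<^sub>R y = (?d, \<phi> ?d *\<^sub>R r)"
    proof (cases "\<phi> ?d = 0")
      case True
      \<comment> \<open>Both nonnegative contributions vanish, so the second component is zero and
        any point of \<open>P\<close> represents it.\<close>
      then have "u * \<phi> a = 0" "v * \<phi> b = 0" using t nn by linarith+
      then show ?thesis using True x y by (intro bexI[of _ p]) auto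
    next
      case False
      \<comment> \<open>The weights are the shares of \<open>a\<close> and \<open>b\<close> in
        \<open>\<phi> ?d\<close>; they sum to 1, so \<open>?r\<close> lies in
        \<open>P\<close>.\<close>
      let ?r = "(u * \<phi> a / \<phi> ?d) *\<^sub>R p + (v * \<phi> b / \<phi> ?d) *\<^sub>R q"
      have pos: "0 < \<phi> ?d" using False t nn by linarith
      have "?r \<in> P"
      proof (rule convexD[OF assms(2) x(3) y(3)])
        show "u * \<phi> a / \<phi> ?d + v * \<phi> b / \<phi> ?d = 1"
          unfolding add_divide_distrib[symmetric] t[symmetric] using False by simp
      qed (use nn pos in auto)
      moreover have "u *\<^sub>R x + v *\<^sub>R y = (?d, \<phi> ?d *\<^sub>R ?r)"
        using False by (simp add: x y scaleR_add_right)
      ultimately show ?thesis by blast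
    qed
    then obtain r where "r \<in> P" "u *\<^sub>R x + v *\<^sub>R y = (?d, \<phi> ?d *\<^sub>R r)" by blast
    then show "u *\<^sub>R x + v *\<^sub>R y \<in> ?U" using dQ by auto
  qed
  then have "semidirect_product Q \<phi> P = ?U" unfolding semidirect_product_def by (rule hull_same)
  then have "z \<in> ?U" using z by simp
  then obtain a x where "a \<in> Q" "x \<in> (\<lambda>x. \<phi> a *\<^sub>R x) ` P" "z = (a, x)" by blast
  then show thesis using that by blast
qed

lemma semidirect_productI: "a \<in> Q \<Longrightarrow> p \<in> P \<Longrightarrow> (a, \<phi> a *\<^sub>R p) \<in> semidirect_product Q \<phi> P"
  unfolding semidirect_product_def by (rule hull_inc) blast

theorem theorem2p17:
  fixes Q :: "(real ^ 'd) set" and P :: "(real ^ 'e) set"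
    and \<S> :: "(real ^ 'd) set set" and \<T> :: "(real ^ 'e) set set"
    and \<phi> :: "real ^ 'd \<Rightarrow> real"
  assumes "lattice_polytope Q" and "lattice_polytope P"
    and "unimodular_triangulation \<S> Q" and "unimodular_triangulation \<T> P"
    and "affine_map \<phi>" and "\<phi> ` integer_points \<subseteq> \<int>" and "\<forall>x\<in>Q. 0 \<le> \<phi> x"
  shows "\<exists>\<U>. unimodular_triangulation \<U> (semidirect_product Q \<phi> P) \<and>
             refines_subdivision \<U> (pullback_subdivision (semidirect_product Q \<phi> P) \<S>)"
proof (cases "Q = {} \<or> P = {}")
  case True
  then have "semidirect_product Q \<phi> P = {}" by (auto simp: semidirect_product_def)
  moreover have "unimodular_triangulation {} ({} :: ((real ^ 'd) \<times> (real ^ 'e)) set)"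
    by (simp add: unimodular_triangulation_def lattice_triangulation_def simplicial_complex_def)
  ultimately show ?thesis by (auto simp: refines_subdivision_def)
next
  case False
  let ?X = "semidirect_product Q \<phi> P"
  obtain KS where S_cx: "unimodular_complex KS" "\<S> = (\<lambda>A. convex hull A) ` KS" "Q = (\<Union>A\<in>KS. convex hull A)"
    using unimodular_triangulation_imp_complex[OF assms(3)] by blast
  obtain KT where T_cx: "unimodular_complex KT" "\<T> = (\<lambda>A. convex hull A) ` KT" "P = (\<Union>A\<in>KT. convex hull A)"
    using unimodular_triangulation_imp_complex[OF assms(4)] by blast
  \<comment> \<open>On the vertices of \<open>KS\<close> the value of \<phi> is a nonnegative
    integer, so there the floor loses nothing.\<close>
  define n where "n v = nat \<lfloor>\<phi> v\<rfloor>" for v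
  have n: "real (n v) = \<phi> v" if v: "v \<in> \<Union>KS" for v
  proof -
    obtain A where A: "A \<in> KS" "v \<in> A" using v by blast
    then have "v \<in> Q" using S_cx(3) by (auto intro: hull_inc)
    moreover have "\<phi> v \<in> \<int>" using unimodular_complex_integer_points[OF S_cx(1) A(1)] A(2) assms(6) by blast
    ultimately show ?thesis using assms(7) by (auto simp: n_def elim: Ints_cases)
  qed
  have finV: "finite (\<Union>KS)" and finW: "finite (\<Union>KT)"
    using S_cx(1) T_cx(1) unimodular_complex_finite unimodular_complex_finite_simplex by (auto intro!: finite_Union)
  obtain key :: "real ^ 'd \<Rightarrow> real" where key: "inj_on key (\<Union>KS)"
    "\<forall>v\<in>\<Union>KS. \<forall>v'\<in>\<Union>KS. key v \<le> key v' \<longrightarrow> n v' \<le> n v"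
    using ex_antitone_key[OF finV] by blast
  define m where "m = card (\<Union>KT)"
  obtain e where e: "bij_betw e {..<m} (\<Union>KT)"
    using ex_bij_betw_nat_finite[OF finW] unfolding m_def atLeast0LessThan by blast
  interpret staircase_complex KS key n KT e "the_inv_into {..<m} e" m
  proof
    show "n v' \<le> n v" if "v \<in> \<Union>KS" "v' \<in> \<Union>KS" "key v \<le> key v'" for v v' using key(2) that by blast
    show "the_inv_into {..<m} e (e i) = i" if "i < m" for i
      using e that by (simp add: bij_betw_def the_inv_into_f_f)
  qed (use finV key(1) S_cx(1) T_cx(1) e in \<open>auto simp: bij_betw_def\<close>)
  have convex: "convex Q" "convex P"
    using assms(1,2) by (auto simp: lattice_polytope_def)
  let ?K = "(`) point ` chains"
  have "?X = (\<Union>A\<in>?K. convex hull A)"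
  proof (intro equalityI subsetI)
    fix z assume "z \<in> ?X"
    then obtain a p where a: "a \<in> Q" and p: "p \<in> P" and z: "z = (a, \<phi> a *\<^sub>R p)"
      using semidirect_productE[OF convex assms(5,7)] by blast
    obtain F' where F': "F' \<in> KS" "a \<in> convex hull F'" using a S_cx(3) by blast
    obtain F \<mu> where F: "F \<subseteq> F'" "\<And>v. v \<in> F \<Longrightarrow> 0 < \<mu> v" "sum \<mu> F = 1" "(\<Sum>v\<in>F. \<mu> v *\<^sub>R v) = a"
      using convex_hull_positive_weights[OF unimodular_complex_finite_simplex[OF S_cx(1) F'(1)] F'(2)] by blast
    obtain G' where G': "G' \<in> KT" "p \<in> convex hull G'" using p T_cx(3) by blast
    obtain G \<nu> where G: "G \<subseteq> G'" "\<And>w. w \<in> G \<Longrightarrow> 0 < \<nu> w" "sum \<nu> G = 1" "(\<Sum>w\<in>G. \<nu> w *\<^sub>R w) = p"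
      using convex_hull_positive_weights[OF unimodular_complex_finite_simplex[OF T_cx(1) G'(1)] G'(2)] by blast
    have FK: "F \<in> KS" and GK: "G \<in> KT"
      using unimodular_complex_subset[OF S_cx(1) F'(1) F(1)] unimodular_complex_subset[OF T_cx(1) G'(1) G(1)] .
    have "\<phi> a = (\<Sum>v\<in>F. \<mu> v * \<phi> v)" using affine_map_sum[OF assms(5) F(3)] F(4) by simp
    also have "\<dots> = (\<Sum>v\<in>F. \<mu> v * real (n v))" 
    proof (rule sum.cong[OF refl])
      fix v assume "v \<in> F"
      then have "v \<in> \<Union>KS" using FK by blast
      then show "\<mu> v * \<phi> v = \<mu> v * real (n v)" by (simp only: n)
    qed
    finally have \<phi>a: "\<phi> a = (\<Sum>v\<in>F. \<mu> v * real (n v))" .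
    have "\<exists>A\<in>chains. z \<in> convex hull (point ` A)"
    proof (cases "\<phi> a = 0")
      case True
      \<comment> \<open>Positive weights of total 0 exist only on the empty simplex, which
        represents the second component 0.\<close>
      have "{} \<in> KT" using unimodular_complex_subset[OF T_cx(1) GK] by blast
      then show ?thesis using ex_chains[OF FK _ F(3), of "{}" "\<nu>"] F(2,4) True \<phi>a z by auto
    next
      case False
      then have "0 < \<phi> a" using a assms(7) by (simp add: less_le)
      moreover have "(\<Sum>w\<in>G. \<phi> a * \<nu> w) = \<phi> a" using G(3) by (simp flip: sum_distrib_left)
      moreover have "(\<Sum>w\<in>G. (\<phi> a * \<nu> w) *\<^sub>R w) = \<phi> a *\<^sub>R p"
        unfolding G(4)[symmetric] scaleR_sum_right by simp
      ultimately show ?thesis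
        using ex_chains[OF FK _ F(3) GK, of "\<lambda>w. \<phi> a * \<nu> w"] F(2,4) G(2) \<phi>a z by simp
    qed
    then show "z \<in> (\<Union>A\<in>?K. convex hull A)" by blast
  next
    fix z assume "z \<in> (\<Union>A\<in>?K. convex hull A)"
    then obtain A where A: "A \<in> chains" "z \<in> convex hull (point ` A)" by blast
    have "point ` A \<subseteq> ?X"
    proof
      fix y assume "y \<in> point ` A"
      then obtain x where x: "x \<in> A" "y = point x" by blast
      have vV: "fst x \<in> \<Union>KS" using chainsD(3)[OF A(1)] x(1) by blast
      then have vQ: "fst x \<in> Q" using S_cx(3) by (auto intro: hull_inc)
      obtain G \<nu> where G: "G \<in> KT" "\<forall>w\<in>G. 0 \<le> \<nu> w" "sum \<nu> G = \<phi> (fst x)"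
        "point x = (fst x, \<Sum>w\<in>G. \<nu> w *\<^sub>R w)"
        using point_weights[OF A(1) x(1)] n[OF vV] by auto
      have finG: "finite G" using unimodular_complex_finite_simplex[OF T_cx(1) G(1)] .
      show "y \<in> ?X"
      proof (cases "\<phi> (fst x) = 0")
        case True
        then have "\<forall>w\<in>G. \<nu> w = 0" using G(2,3) sum_nonneg_eq_0_iff[OF finG, of \<nu>] by simp
        \<comment> \<open>The point is \<open>(fst x, 0)\<close>, and any point of \<open>P\<close>
          scaled by 0 represents it.\<close>
        moreover obtain p where "p \<in> P" using \<open>\<not> (Q = {} \<or> P = {})\<close> by blast
        ultimately show ?thesis
          using semidirect_productI[OF vQ, of p P \<phi>] True x(2) G(4) by simp
      next
        case False
        then have pos: "0 < \<phi> (fst x)" using vQ assms(7) by (simp add: less_le)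
        let ?p = "\<Sum>w\<in>G. (\<nu> w / \<phi> (fst x)) *\<^sub>R w"
        have "?p \<in> convex hull G"
          using G(2,3) pos by (intro convex_sum[OF finG convex_convex_hull]) (auto intro: hull_inc simp flip: sum_divide_distrib)
        then have "?p \<in> P" using T_cx(3) G(1) by blast
        moreover have "\<phi> (fst x) *\<^sub>R ?p = (\<Sum>w\<in>G. \<nu> w *\<^sub>R w)"
          using False by (simp add: scaleR_sum_right)
        ultimately show ?thesis using semidirect_productI[OF vQ, of ?p P \<phi>] x(2) G(4) by simp
      qed
    qed
    then have "convex hull (point ` A) \<subseteq> ?X"
      by (rule hull_minimal) (simp add: semidirect_product_def)
    then show "z \<in> ?X" using A(2) by blast
  qed
  moreover obtain a p where "a \<in> Q" "p \<in> P" using False by blast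
  then have "?X \<noteq> {}" using semidirect_productI by blast
  ultimately have X: "?X = (\<Union>A\<in>?K. convex hull A)" and "?X \<noteq> {}" by blast+
  have "?K \<noteq> {{}}"
  proof
    assume "?K = {{}}"
    then have "?X = {}" unfolding X by (simp only: UN_simps convex_hull_empty) simp
    then show False using \<open>?X \<noteq> {}\<close> by blast
  qed
  then have "unimodular_triangulation ((\<lambda>A. convex hull A) ` ?K) ?X"
    unfolding X by (rule unimodular_complex_imp_triangulation[OF unimodular_complex_chains])
  moreover have "refines_subdivision ((\<lambda>A. convex hull A) ` ?K) (pullback_subdivision ?X \<S>)"
    unfolding refines_subdivision_def
  proof
    fix U assume U: "U \<in> (\<lambda>A. convex hull A) ` ?K"
    then obtain A where A: "A \<in> chains" "U = convex hull (point ` A)" by blast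
    \<comment> \<open>The projection is linear, so a cell is mapped onto the hull of the first
      components of its chain, which is a cell of \<S>.\<close>
    have "fst ` (convex hull (point ` A)) = convex hull (fst ` point ` A)"
      by (rule convex_hull_linear_image) (rule linear_fst)
    also have "fst ` point ` A = fst ` A" by (force simp: point_def image_image)
    finally have "U \<subseteq> ?X \<inter> fst -` (convex hull (fst ` A))" using U X A(2) by blast
    moreover have "convex hull (fst ` A) \<in> \<S>" using S_cx(2) chainsD(3)[OF A(1)] by blast
    ultimately show "\<exists>V\<in>pullback_subdivision ?X \<S>. U \<subseteq> V" unfolding pullback_subdivision_def by blast
  qed
  ultimately show ?thesis by blast
qed

end
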